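(* Let $\Gamma$ be a Polish space and let $K\subseteq\mathbb R^\Gamma$ be a set of real-valued functions on $\Gamma$ which, in the topology of pointwise convergence on $\Gamma$, is compact and separable. Assume further that each function in $K$ has only countably many points of discontinuity in $\Gamma$. Then the Banach space $\mathcal C(K)$ of continuous real-valued functions on $K$ admits a norm that is equivalent to the supremum norm, is lower semicontinuous for the topology $\mathfrak T_p$ of pointwise convergence on $K$, and is locally uniformly rotund.
   Context: A topological space is Polish if it is separable and completely metrizable. $\mathfrak T_p$ denotes the topology of pointwise convergence on $K$ in $\mathcal C(K)$. A norm $\nu$ on a real vector space $X$ is locally uniformly rotund (LUR) if whenever $x, x_n\in X$ ($n\in\mathbb N$) are such that $\nu(x_n)\to\nu(x)$ and $\nu(\tfrac12(x+x_n))\to\nu(x)$ as $n\to\infty$, one has $\nu(x-x_n)\to 0$. *)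

theory Defs
  imports "HOL-Analysis.Analysis"
begin

definition polish_topology :: "'a topology \<Rightarrow> bool" where
  "polish_topology X \<longleftrightarrow> separable_space X \<and> completely_metrizable_space X"

definition discontinuities :: "'a topology \<Rightarrow> ('a \<Rightarrow> real) \<Rightarrow> 'a set" where
  "discontinuities X f = {x \<in> topspace X. \<not> topcontinuous_at X euclideanreal f x}"

definition lower_semicontinuous_map :: "'a topology \<Rightarrow> ('a \<Rightarrow> real) \<Rightarrow> bool" where
  "lower_semicontinuous_map X f \<longleftrightarrow> (\<forall>c. openin X {x \<in> topspace X. c < f x})"

text \<open>Functions on a set \<open>S\<close> are represented as elements of \<open>extensional S\<close>, so the
  vector space operations are the pointwise ones, restricted to \<open>S\<close>.\<close>

definition fun_zero :: "'a set \<Rightarrow> 'a \<Rightarrow> real" where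
  "fun_zero S = (\<lambda>s\<in>S. 0)"

definition fun_add :: "'a set \<Rightarrow> ('a \<Rightarrow> real) \<Rightarrow> ('a \<Rightarrow> real) \<Rightarrow> 'a \<Rightarrow> real" where
  "fun_add S f g = (\<lambda>s\<in>S. f s + g s)"

definition fun_diff :: "'a set \<Rightarrow> ('a \<Rightarrow> real) \<Rightarrow> ('a \<Rightarrow> real) \<Rightarrow> 'a \<Rightarrow> real" where
  "fun_diff S f g = (\<lambda>s\<in>S. f s - g s)"

definition fun_scale :: "'a set \<Rightarrow> real \<Rightarrow> ('a \<Rightarrow> real) \<Rightarrow> 'a \<Rightarrow> real" where
  "fun_scale S c f = (\<lambda>s\<in>S. c * f s)"

text \<open>In the following, \<open>V\<close> is meant to be a linear space of functions on \<open>S\<close>;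
  the values of \<open>\<nu>\<close> outside \<open>V\<close> are irrelevant.\<close>

definition norm_on :: "'a set \<Rightarrow> ('a \<Rightarrow> real) set \<Rightarrow> (('a \<Rightarrow> real) \<Rightarrow> real) \<Rightarrow> bool" where
  "norm_on S V \<nu> \<longleftrightarrow>
     (\<forall>f\<in>V. 0 \<le> \<nu> f) \<and>
     (\<forall>f\<in>V. \<nu> f = 0 \<longleftrightarrow> f = fun_zero S) \<and>
     (\<forall>f\<in>V. \<forall>c. \<nu> (fun_scale S c f) = \<bar>c\<bar> * \<nu> f) \<and>
     (\<forall>f\<in>V. \<forall>g\<in>V. \<nu> (fun_add S f g) \<le> \<nu> f + \<nu> g)"

definition equivalent_norms_on ::
    "('a \<Rightarrow> real) set \<Rightarrow> (('a \<Rightarrow> real) \<Rightarrow> real) \<Rightarrow> (('a \<Rightarrow> real) \<Rightarrow> real) \<Rightarrow> bool" where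
  "equivalent_norms_on V \<mu> \<nu> \<longleftrightarrow>
     (\<exists>a>0. \<exists>b>0. \<forall>f\<in>V. a * \<mu> f \<le> \<nu> f \<and> \<nu> f \<le> b * \<mu> f)"

definition locally_uniformly_rotund_on ::
    "'a set \<Rightarrow> ('a \<Rightarrow> real) set \<Rightarrow> (('a \<Rightarrow> real) \<Rightarrow> real) \<Rightarrow> bool" where
  "locally_uniformly_rotund_on S V \<nu> \<longleftrightarrow>
     (\<forall>f\<in>V. \<forall>F :: nat \<Rightarrow> 'a \<Rightarrow> real. (\<forall>n. F n \<in> V) \<longrightarrow>
        (\<lambda>n. \<nu> (F n)) \<longlonglongrightarrow> \<nu> f \<longrightarrow>
        (\<lambda>n. \<nu> (fun_scale S (1/2) (fun_add S f (F n)))) \<longlonglongrightarrow> \<nu> f \<longrightarrow>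
        (\<lambda>n. \<nu> (fun_diff S f (F n))) \<longlonglongrightarrow> 0)"

text \<open>\<open>cfunspace\<close> consists of the bounded continuous functions with the supremum metric;
  on a compact space boundedness is automatic (lemma \<open>cont_funs_compact\<close>).\<close>

definition cont_funs :: "'a topology \<Rightarrow> ('a \<Rightarrow> real) set" where
  "cont_funs X = mspace (cfunspace X euclidean_metric)"

definition sup_norm :: "'a topology \<Rightarrow> ('a \<Rightarrow> real) \<Rightarrow> real" where
  "sup_norm X f = mdist (cfunspace X euclidean_metric) f (fun_zero (topspace X))"

definition pointwise_topology :: "'a topology \<Rightarrow> ('a \<Rightarrow> real) topology" where
  "pointwise_topology X = subtopology (powertop_real (topspace X)) (cont_funs X)"

lemma cont_funs_compact:
  assumes "compact_space X"
  shows "cont_funs X = {f \<in> extensional (topspace X). continuous_map X euclideanreal f}"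
proof -
  have "bounded (f ` topspace X)" if "continuous_map X euclideanreal f" for f :: "'a \<Rightarrow> real"
  proof -
    have "compactin euclideanreal (f ` topspace X)"
      using assms that image_compactin unfolding compact_space_def by blast
    then show ?thesis
      by (simp add: compact_imp_bounded)
  qed
  moreover have "Metric_space.mbounded UNIV dist B \<longleftrightarrow> bounded B" for B :: "real set"
    by (metis mbounded_iff_bounded)
  ultimately show ?thesis
    by (auto simp: cont_funs_def)
qed

lemma fun_zero_in_cont_funs: "fun_zero (topspace X) \<in> cont_funs X"
proof -
  have "Metric_space.mbounded UNIV dist ((\<lambda>s\<in>topspace X. 0::real) ` topspace X)"
    unfolding mbounded_iff_bounded
    by (rule bounded_subset[of "{0}"]) auto
  moreover have "continuous_map X euclideanreal (\<lambda>s\<in>topspace X. 0::real)"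
    by (rule continuous_map_eq[of _ _ "\<lambda>_. 0"]) auto
  ultimately show ?thesis
    by (auto simp: cont_funs_def fun_zero_def)
qed

lemma topspace_pointwise_topology: "topspace (pointwise_topology X) = cont_funs X"
  by (auto simp: pointwise_topology_def cont_funs_def PiE_UNIV_domain PiE_def)

lemma sup_norm_eq:
  assumes "f \<in> cont_funs X" "topspace X \<noteq> {}"
  shows "sup_norm X f = (SUP x\<in>topspace X. \<bar>f x\<bar>)"
proof -
  have "f \<in> Metric_space.fspace UNIV dist (topspace X)"
    "fun_zero (topspace X) \<in> Metric_space.fspace UNIV dist (topspace X)"
    using assms fun_zero_in_cont_funs[of X] by (auto simp: cont_funs_def Metric_space.fspace_def[OF Met_TC.Metric_space_axioms])
  moreover have "(\<lambda>x. dist (f x) (fun_zero (topspace X) x)) ` topspace X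
      = (\<lambda>x. \<bar>f x\<bar>) ` topspace X"
    by (auto simp: fun_zero_def)
  ultimately show ?thesis
    using assms by (simp add: sup_norm_def mdist_cfunspace_eq_mdist_funspace Metric_space.fdist_def[OF Met_TC.Metric_space_axioms])
qed

end

theory Submission
  imports Defs
begin

text \<open>
  Local uniform rotundity of a norm whose square is a weighted sum of squares of seminorms follows if
  convergence to \<open>0\<close> of the rotundity defects \<open>2 N(f)\<^sup>2 + 2 N(f\<^sub>r)\<^sup>2 - N(f + f\<^sub>r)\<^sup>2\<close> for all these
  seminorms forces \<open>f\<^sub>r\<close> to converge uniformly to \<open>f\<close> (\<open>renorming_criterion\<close>). So the task is to find countably many
  bounded, pointwise lower semicontinuous seminorms on \<open>C(K)\<close> with this effect. The evaluations at a countable dense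
  set \<open>D\<close> of \<open>K\<close> give convergence on \<open>D\<close>. To pass from \<open>D\<close> to \<open>K\<close> one needs a finite set \<open>M\<close> of points of \<open>\<Gamma>\<close> that
  controls \<open>f\<close> and almost all \<open>f\<^sub>r\<close> simultaneously: the values of each of these functions at \<open>s\<close> and \<open>t\<close> differ little
  whenever \<open>s\<close> and \<open>t\<close> are close on \<open>M\<close>. Continuity of \<open>f\<close> provides such an \<open>M\<close> for \<open>f\<close>, and for a fixed \<open>M\<close> the oscillation left
  over by \<open>M\<close> is a seminorm that could be used to carry the control over to \<open>f\<^sub>r\<close>. The difficulty is that
  uncountably many sets \<open>M\<close> occur.

  Suprema of seminorms help. If the defect of \<open>sup\<^sub>i N\<^sub>i\<close> tends to \<open>0\<close>, there are indices that nearly attain the supremum at \<open>f\<close> and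
  along which the defects of \<open>N\<^sub>i\<close> tend to \<open>0\<close> (\<open>rotundity_defect_sup\<close>). Here the indices are pairs \<open>p = (s, t)\<close>
  that are close on a countable dense set \<open>Q\<close> of \<open>\<Gamma>\<close> and, in a given basic open set, are apart at a single point \<open>\<gamma>\<close>. If near-maximality of
  \<open>|f s - f t|\<close> determines \<open>\<gamma>\<close>, the defects of any seminorm attached to \<open>\<gamma>\<close> tend to \<open>0\<close> (\<open>pinned_insert\<close>).
  Iterating this, one finds further points of \<open>\<Gamma>\<close> from \<open>f\<close> by finite lists of instructions, of which there are only
  countably many.

  The points that can be found in this way suffice to control \<open>f\<close> (\<open>pinned_set_controls\<close>), and this
  is where the countability of the sets of discontinuities is used. A pair that is close on \<open>Q\<close> can only be apart at discontinuities of
  its two members, and the same is true of the closure of the set where it is apart. Among the pairs on which \<open>f\<close> oscillates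
  and which are close at all points found, choose one for which this closure \<open>A\<close> is minimal. Then
  \<open>A\<close> is a countable closed subset of a Polish space, so by the Baire category theorem it has an isolated point. By minimality all
  such pairs that are close outside \<open>A\<close> are apart at this isolated point, and by compactness of \<open>K\<close> this makes the point one of those that can be
  found, which is absurd.
\<close>

section \<open>Lower semicontinuous seminorms on a space of continuous functions\<close>

lemma lower_semicontinuous_map_const: "lower_semicontinuous_map X (\<lambda>x. c)"
  unfolding lower_semicontinuous_map_def
proof
  fix d
  show "openin X {x \<in> topspace X. d < c}" by (cases "d < c") auto
qed

lemma lower_semicontinuous_map_eq:
  assumes "lower_semicontinuous_map X f" "\<And>x. x \<in> topspace X \<Longrightarrow> f x = g x"
  shows "lower_semicontinuous_map X g"
proof -
  have "{x \<in> topspace X. c < g x} = {x \<in> topspace X. c < f x}" for c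
    using assms(2) by auto
  with assms(1) show ?thesis by (simp add: lower_semicontinuous_map_def)
qed

lemma continuous_imp_lower_semicontinuous_map:
  assumes "continuous_map X euclideanreal f"
  shows "lower_semicontinuous_map X f"
  unfolding lower_semicontinuous_map_def
proof
  fix c
  have "openin X {x \<in> topspace X. f x \<in> {c<..}}"
    by (rule openin_continuous_map_preimage[OF assms]) auto
  then show "openin X {x \<in> topspace X. c < f x}" by simp
qed

text \<open>A sum exceeds \<open>c\<close> at a point exactly when the two summands exceed some \<open>q\<close> and \<open>c - q\<close>
  there, which makes the set a union of intersections of open sets.\<close>

lemma lower_semicontinuous_map_add:
  assumes "lower_semicontinuous_map X f" "lower_semicontinuous_map X g"
  shows "lower_semicontinuous_map X (\<lambda>x. f x + g x)"
  unfolding lower_semicontinuous_map_def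
proof
  fix c
  have "(c < f x + g x) \<longleftrightarrow> (\<exists>q. q < f x \<and> c - q < g x)" for x
  proof
    assume "c < f x + g x"
    then have "(f x + c - g x) / 2 < f x \<and> c - (f x + c - g x) / 2 < g x"
      by (simp add: field_simps)
    then show "\<exists>q. q < f x \<and> c - q < g x" by blast
  qed auto
  then have "{x \<in> topspace X. c < f x + g x}
     = (\<Union>q. {x \<in> topspace X. q < f x} \<inter> {x \<in> topspace X. c - q < g x})"
    by auto
  also have "openin X \<dots>"
    using assms by (auto simp: lower_semicontinuous_map_def)
  finally show "openin X {x \<in> topspace X. c < f x + g x}" .
qed

lemma lower_semicontinuous_map_cmul:
  assumes "lower_semicontinuous_map X f" "0 \<le> k"
  shows "lower_semicontinuous_map X (\<lambda>x. k * f x)"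
proof (cases "k = 0")
  case False
  then have "{x \<in> topspace X. c < k * f x} = {x \<in> topspace X. c / k < f x}" for c
    using assms(2) by (auto simp: field_simps)
  then show ?thesis using assms(1) by (simp add: lower_semicontinuous_map_def)
qed (simp add: lower_semicontinuous_map_const)

lemma lower_semicontinuous_map_sqrt:
  assumes "lower_semicontinuous_map X f" "\<And>x. x \<in> topspace X \<Longrightarrow> 0 \<le> f x"
  shows "lower_semicontinuous_map X (\<lambda>x. sqrt (f x))"
  unfolding lower_semicontinuous_map_def
proof
  fix c
  show "openin X {x \<in> topspace X. c < sqrt (f x)}"
  proof (cases "c < 0")
    case True
    then have "{x \<in> topspace X. c < sqrt (f x)} = topspace X"
      using assms(2) by (auto intro: less_le_trans)
    then show ?thesis by simp
  next
    case False
    then have "c < sqrt y \<longleftrightarrow> c\<^sup>2 < y" for y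
      by (metis real_less_rsqrt real_sqrt_less_iff real_sqrt_abs abs_of_nonneg not_less)
    then show ?thesis using assms(1) by (simp add: lower_semicontinuous_map_def)
  qed
qed

lemma lower_semicontinuous_map_power2:
  assumes "lower_semicontinuous_map X f" "\<And>x. x \<in> topspace X \<Longrightarrow> 0 \<le> f x"
  shows "lower_semicontinuous_map X (\<lambda>x. (f x)\<^sup>2)"
  unfolding lower_semicontinuous_map_def
proof
  fix c
  show "openin X {x \<in> topspace X. c < (f x)\<^sup>2}"
  proof (cases "c < 0")
    case True
    then have "{x \<in> topspace X. c < (f x)\<^sup>2} = topspace X"
      by (auto intro: less_le_trans)
    then show ?thesis by simp
  next
    case False
    then have "c < y\<^sup>2 \<longleftrightarrow> sqrt c < y" if "0 \<le> y" for y
      using that by (metis real_sqrt_less_iff real_sqrt_abs abs_of_nonneg)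
    then have "{x \<in> topspace X. c < (f x)\<^sup>2} = {x \<in> topspace X. sqrt c < f x}"
      using assms(2) by auto
    then show ?thesis using assms(1) by (simp add: lower_semicontinuous_map_def)
  qed
qed

lemma lower_semicontinuous_map_Sup:
  assumes "\<And>i. i \<in> I \<Longrightarrow> lower_semicontinuous_map X (f i)" "I \<noteq> {}"
    and "\<And>x. x \<in> topspace X \<Longrightarrow> bdd_above ((\<lambda>i. f i x) ` I)"
  shows "lower_semicontinuous_map X (\<lambda>x. SUP i\<in>I. f i x)"
  unfolding lower_semicontinuous_map_def
proof
  fix c
  have "{x \<in> topspace X. c < (SUP i\<in>I. f i x)} = (\<Union>i\<in>I. {x \<in> topspace X. c < f i x})"
    using less_cSUP_iff[OF assms(2) assms(3)] by blast
  also have "openin X \<dots>"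
    using assms(1) by (auto simp: lower_semicontinuous_map_def)
  finally show "openin X {x \<in> topspace X. c < (SUP i\<in>I. f i x)}" .
qed

lemma fun_add_in_cont_funs:
  assumes "compact_space X" "f \<in> cont_funs X" "g \<in> cont_funs X"
  shows "fun_add (topspace X) f g \<in> cont_funs X"
proof -
  have "continuous_map X euclideanreal (\<lambda>x. f x + g x)"
    using assms by (auto simp: cont_funs_compact intro!: continuous_intros)
  then have "continuous_map X euclideanreal (fun_add (topspace X) f g)"
    by (rule continuous_map_eq) (auto simp: fun_add_def)
  then show ?thesis using assms(1) by (simp add: cont_funs_compact fun_add_def)
qed

lemma fun_diff_in_cont_funs:
  assumes "compact_space X" "f \<in> cont_funs X" "g \<in> cont_funs X"
  shows "fun_diff (topspace X) f g \<in> cont_funs X"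
proof -
  have "continuous_map X euclideanreal (\<lambda>x. f x - g x)"
    using assms by (auto simp: cont_funs_compact intro!: continuous_intros)
  then have "continuous_map X euclideanreal (fun_diff (topspace X) f g)"
    by (rule continuous_map_eq) (auto simp: fun_diff_def)
  then show ?thesis using assms(1) by (simp add: cont_funs_compact fun_diff_def)
qed

lemma fun_scale_in_cont_funs:
  assumes "compact_space X" "f \<in> cont_funs X"
  shows "fun_scale (topspace X) t f \<in> cont_funs X"
proof -
  have "continuous_map X euclideanreal (\<lambda>x. t * f x)"
    using assms by (auto simp: cont_funs_compact intro!: continuous_intros)
  then have "continuous_map X euclideanreal (fun_scale (topspace X) t f)"
    by (rule continuous_map_eq) (auto simp: fun_scale_def)
  then show ?thesis using assms(1) by (simp add: cont_funs_compact fun_scale_def)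
qed

lemma abs_le_sup_norm:
  assumes "f \<in> cont_funs X" "x \<in> topspace X"
  shows "\<bar>f x\<bar> \<le> sup_norm X f"
proof -
  have "bounded (f ` topspace X)"
    using assms by (auto simp: cont_funs_def mbounded_iff_bounded)
  then have "bdd_above ((\<lambda>x. \<bar>f x\<bar>) ` topspace X)"
    by (auto simp: bounded_real bdd_above_def)
  then show ?thesis
    using assms by (subst sup_norm_eq) (auto intro: cSUP_upper)
qed

lemma sup_norm_empty:
  assumes "f \<in> cont_funs X" "topspace X = {}"
  shows "sup_norm X f = 0"
proof -
  have "f = fun_zero (topspace X)"
    using assms by (auto simp: cont_funs_def fun_zero_def)
  then show ?thesis
    using fun_zero_in_cont_funs[of X] by (simp add: sup_norm_def cont_funs_def)
qed

lemma sup_norm_nonneg: "0 \<le> sup_norm X f"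
  by (simp add: sup_norm_def)

lemma sup_norm_le:
  assumes "f \<in> cont_funs X" "0 \<le> c" "\<And>x. x \<in> topspace X \<Longrightarrow> \<bar>f x\<bar> \<le> c"
  shows "sup_norm X f \<le> c"
proof (cases "topspace X = {}")
  case False
  then show ?thesis using assms by (subst sup_norm_eq) (auto intro: cSUP_least)
qed (use assms sup_norm_empty in force)

text \<open>The building blocks of the norm. The constant \<open>c\<close> is carried along because suprema over
  infinite families and infinite sums of seminorms need a common bound.\<close>

definition lsc_seminorm :: "'a topology \<Rightarrow> real \<Rightarrow> (('a \<Rightarrow> real) \<Rightarrow> real) \<Rightarrow> bool" where
  "lsc_seminorm X c N \<longleftrightarrow>
     (\<forall>f\<in>cont_funs X. 0 \<le> N f \<and> N f \<le> c * sup_norm X f) \<and>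
     (\<forall>f\<in>cont_funs X. \<forall>t. N (fun_scale (topspace X) t f) = \<bar>t\<bar> * N f) \<and>
     (\<forall>f\<in>cont_funs X. \<forall>g\<in>cont_funs X. N (fun_add (topspace X) f g) \<le> N f + N g) \<and>
     lower_semicontinuous_map (pointwise_topology X) N"

lemma lsc_seminormD:
  assumes "lsc_seminorm X c N" "f \<in> cont_funs X"
  shows lsc_seminorm_nonneg: "0 \<le> N f" and lsc_seminorm_le: "N f \<le> c * sup_norm X f"
    and lsc_seminorm_scale: "N (fun_scale (topspace X) t f) = \<bar>t\<bar> * N f"
    and lsc_seminorm_triangle: "g \<in> cont_funs X \<Longrightarrow> N (fun_add (topspace X) f g) \<le> N f + N g"
  using assms by (auto simp: lsc_seminorm_def)

lemma lsc_seminorm_lsc: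
  "lsc_seminorm X c N \<Longrightarrow> lower_semicontinuous_map (pointwise_topology X) N"
  by (simp add: lsc_seminorm_def)

lemma lsc_seminorm_mono:
  assumes "lsc_seminorm X c N" "c \<le> d"
  shows "lsc_seminorm X d N"
proof -
  have "c * sup_norm X f \<le> d * sup_norm X f" for f
    using assms(2) by (simp add: mult_right_mono sup_norm_nonneg)
  then show ?thesis using assms(1) unfolding lsc_seminorm_def by (meson order_trans)
qed

lemma continuous_map_evaluation:
  assumes "x \<in> topspace X"
  shows "continuous_map (pointwise_topology X) euclideanreal (\<lambda>f. f x)"
  unfolding pointwise_topology_def using assms
  by (intro continuous_map_from_subtopology continuous_map_product_projection)

lemma lsc_seminorm_eval:
  assumes "x \<in> topspace X"
  shows "lsc_seminorm X 1 (\<lambda>f. \<bar>f x\<bar>)"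
  using assms continuous_map_evaluation[OF assms]
  by (auto simp: lsc_seminorm_def fun_scale_def fun_add_def abs_mult abs_le_sup_norm
      intro!: continuous_imp_lower_semicontinuous_map continuous_intros)

lemma lsc_seminorm_diff:
  assumes "x \<in> topspace X" "y \<in> topspace X"
  shows "lsc_seminorm X 2 (\<lambda>f. \<bar>f x - f y\<bar>)"
proof -
  have "lower_semicontinuous_map (pointwise_topology X) (\<lambda>f. \<bar>f x - f y\<bar>)"
    using continuous_map_evaluation[OF assms(1)] continuous_map_evaluation[OF assms(2)]
    by (intro continuous_imp_lower_semicontinuous_map continuous_intros)
  moreover have "\<bar>f x - f y\<bar> \<le> 2 * sup_norm X f" if "f \<in> cont_funs X" for f
    using abs_le_sup_norm[OF that assms(1)] abs_le_sup_norm[OF that assms(2)] by linarith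
  moreover have "\<bar>t * f x - t * f y\<bar> = \<bar>t\<bar> * \<bar>f x - f y\<bar>" for t and f :: "'a \<Rightarrow> real"
    by (metis abs_mult right_diff_distrib)
  ultimately show ?thesis
    using assms by (auto simp: lsc_seminorm_def fun_scale_def fun_add_def)
qed

text \<open>The triangle inequality is that of the plane with its Euclidean norm, applied to the vectors
  \<open>(N f, sqrt k * L f)\<close>; lower semicontinuity is checked on the squares.\<close>

lemma lsc_seminorm_l2:
  assumes X: "compact_space X" and N: "lsc_seminorm X a N" and L: "lsc_seminorm X b L" and "0 \<le> k" "0 \<le> c"
    and le: "a\<^sup>2 + k * b\<^sup>2 \<le> c\<^sup>2"
  shows "lsc_seminorm X c (\<lambda>f. sqrt ((N f)\<^sup>2 + k * (L f)\<^sup>2))"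
  unfolding lsc_seminorm_def
proof (intro conjI ballI allI)
  fix f assume f: "f \<in> cont_funs X"
  let ?s = "sup_norm X f"
  show "0 \<le> sqrt ((N f)\<^sup>2 + k * (L f)\<^sup>2)" using \<open>0 \<le> k\<close> by simp
  have "(N f)\<^sup>2 \<le> (a * ?s)\<^sup>2" "(L f)\<^sup>2 \<le> (b * ?s)\<^sup>2"
    using lsc_seminormD[OF N f] lsc_seminormD[OF L f] by (auto intro!: power_mono)
  then have "(N f)\<^sup>2 + k * (L f)\<^sup>2 \<le> (a * ?s)\<^sup>2 + k * (b * ?s)\<^sup>2"
    using \<open>0 \<le> k\<close> by (intro add_mono mult_left_mono)
  also have "\<dots> = (a\<^sup>2 + k * b\<^sup>2) * ?s\<^sup>2" by (simp add: algebra_simps power_mult_distrib)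
  also have "\<dots> \<le> (c * ?s)\<^sup>2" using le by (simp add: power_mult_distrib mult_right_mono)
  finally show "sqrt ((N f)\<^sup>2 + k * (L f)\<^sup>2) \<le> c * ?s"
    using \<open>0 \<le> c\<close> sup_norm_nonneg[of X f] by (intro real_le_lsqrt) auto
next
  fix f t assume f: "f \<in> cont_funs X"
  have "(N (fun_scale (topspace X) t f))\<^sup>2 + k * (L (fun_scale (topspace X) t f))\<^sup>2
     = t\<^sup>2 * ((N f)\<^sup>2 + k * (L f)\<^sup>2)"
    by (simp add: lsc_seminorm_scale[OF N f] lsc_seminorm_scale[OF L f] power_mult_distrib algebra_simps)
  then show "sqrt ((N (fun_scale (topspace X) t f))\<^sup>2 + k * (L (fun_scale (topspace X) t f))\<^sup>2)
     = \<bar>t\<bar> * sqrt ((N f)\<^sup>2 + k * (L f)\<^sup>2)"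
    by (simp add: real_sqrt_mult)
next
  fix f g assume fg: "f \<in> cont_funs X" "g \<in> cont_funs X"
  let ?h = "fun_add (topspace X) f g"
  have *: "k * (x::real)\<^sup>2 = (sqrt k * x)\<^sup>2" for x
    using \<open>0 \<le> k\<close> by (simp add: power_mult_distrib)
  have 1: "sqrt ((N f + N g)\<^sup>2 + (sqrt k * L f + sqrt k * L g)\<^sup>2)
    \<le> sqrt ((N f)\<^sup>2 + (sqrt k * L f)\<^sup>2) + sqrt ((N g)\<^sup>2 + (sqrt k * L g)\<^sup>2)"
    by (rule real_sqrt_sum_squares_triangle_ineq)
  have h: "?h \<in> cont_funs X" by (rule fun_add_in_cont_funs[OF X fg])
  have "(N ?h)\<^sup>2 + (sqrt k * L ?h)\<^sup>2 \<le> (N f + N g)\<^sup>2 + (sqrt k * L f + sqrt k * L g)\<^sup>2"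
    using lsc_seminorm_nonneg[OF N h] lsc_seminorm_nonneg[OF L h]
      lsc_seminorm_triangle[OF N fg] lsc_seminorm_triangle[OF L fg] \<open>0 \<le> k\<close>
    by (intro add_mono power_mono) (auto simp flip: distrib_left intro: mult_left_mono)
  then have "sqrt ((N ?h)\<^sup>2 + (sqrt k * L ?h)\<^sup>2)
    \<le> sqrt ((N f + N g)\<^sup>2 + (sqrt k * L f + sqrt k * L g)\<^sup>2)" by simp
  with 1 show "sqrt ((N ?h)\<^sup>2 + k * (L ?h)\<^sup>2)
    \<le> sqrt ((N f)\<^sup>2 + k * (L f)\<^sup>2) + sqrt ((N g)\<^sup>2 + k * (L g)\<^sup>2)"
    unfolding * by linarith
next
  show "lower_semicontinuous_map (pointwise_topology X) (\<lambda>f. sqrt ((N f)\<^sup>2 + k * (L f)\<^sup>2))"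
    using assms
    by (intro lower_semicontinuous_map_sqrt lower_semicontinuous_map_add
        lower_semicontinuous_map_cmul lower_semicontinuous_map_power2)
      (auto simp: topspace_pointwise_topology lsc_seminorm_lsc lsc_seminorm_nonneg)
qed

text \<open>The element \<open>0\<close> is inserted so that an empty family has supremum \<open>0\<close>.\<close>

definition sup_seminorm :: "'i set \<Rightarrow> ('i \<Rightarrow> ('a \<Rightarrow> real) \<Rightarrow> real) \<Rightarrow> ('a \<Rightarrow> real) \<Rightarrow> real" where
  "sup_seminorm I N f = Sup (insert 0 ((\<lambda>i. N i f) ` I))"

lemma sup_seminorm_bdd:
  assumes "\<And>i. i \<in> I \<Longrightarrow> lsc_seminorm X c (N i)" "f \<in> cont_funs X"
  shows "bdd_above (insert 0 ((\<lambda>i. N i f) ` I))"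
proof (rule bdd_aboveI)
  fix y assume "y \<in> insert 0 ((\<lambda>i. N i f) ` I)"
  then show "y \<le> \<bar>c\<bar> * sup_norm X f"
  proof
    assume "y \<in> (\<lambda>i. N i f) ` I"
    then obtain i where "i \<in> I" "y = N i f" by blast
    then have "y \<le> c * sup_norm X f" using lsc_seminorm_le[OF assms(1) assms(2)] by blast
    also have "\<dots> \<le> \<bar>c\<bar> * sup_norm X f" by (intro mult_right_mono) (auto simp: sup_norm_nonneg)
    finally show ?thesis .
  qed (simp add: sup_norm_nonneg)
qed

lemma le_sup_seminorm:
  assumes "\<And>i. i \<in> I \<Longrightarrow> lsc_seminorm X c (N i)" "f \<in> cont_funs X" "i \<in> I"
  shows "N i f \<le> sup_seminorm I N f"
  unfolding sup_seminorm_def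
  by (rule cSup_upper[OF _ sup_seminorm_bdd[OF assms(1,2)]]) (use assms(3) in auto)

lemma sup_seminorm_nonneg:
  assumes "\<And>i. i \<in> I \<Longrightarrow> lsc_seminorm X c (N i)" "f \<in> cont_funs X"
  shows "0 \<le> sup_seminorm I N f"
  unfolding sup_seminorm_def
  by (rule cSup_upper[OF _ sup_seminorm_bdd[OF assms]]) auto

lemma sup_seminorm_le:
  assumes "0 \<le> b" "\<And>i. i \<in> I \<Longrightarrow> N i f \<le> b"
  shows "sup_seminorm I N f \<le> b"
  unfolding sup_seminorm_def using assms by (intro cSup_least) auto

lemma lsc_seminorm_sup:
  assumes X: "compact_space X" and N: "\<And>i. i \<in> I \<Longrightarrow> lsc_seminorm X c (N i)" and "0 \<le> c"
  shows "lsc_seminorm X c (sup_seminorm I N)"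
  unfolding lsc_seminorm_def
proof (intro conjI ballI allI)
  fix f assume f: "f \<in> cont_funs X"
  show "0 \<le> sup_seminorm I N f" by (rule sup_seminorm_nonneg[OF N f])
  show "sup_seminorm I N f \<le> c * sup_norm X f"
    using lsc_seminorm_le[OF N f] \<open>0 \<le> c\<close> by (intro sup_seminorm_le) (auto simp: sup_norm_nonneg)
next
  fix f t assume f: "f \<in> cont_funs X"
  have le: "sup_seminorm I N (fun_scale (topspace X) t f) \<le> \<bar>t\<bar> * sup_seminorm I N f"
    if f: "f \<in> cont_funs X" for t f
    using le_sup_seminorm[where N = N and I = I, OF N f]
      sup_seminorm_nonneg[where N = N and I = I, OF N f] lsc_seminorm_scale[OF N f]
    by (intro sup_seminorm_le) (auto intro!: mult_left_mono)
  show "sup_seminorm I N (fun_scale (topspace X) t f) = \<bar>t\<bar> * sup_seminorm I N f"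
  proof (rule antisym[OF le[OF f]])
    show "\<bar>t\<bar> * sup_seminorm I N f \<le> sup_seminorm I N (fun_scale (topspace X) t f)"
    proof (cases "t = 0")
      case True
      then show ?thesis
        using sup_seminorm_nonneg[OF N fun_scale_in_cont_funs[OF X f]] by simp
    next
      case False
      let ?g = "fun_scale (topspace X) t f"
      have "fun_scale (topspace X) (1/t) ?g = f"
        using f False by (auto simp: fun_scale_def cont_funs_def extensional_def)
      then have "sup_seminorm I N f \<le> \<bar>1/t\<bar> * sup_seminorm I N ?g"
        using le[OF fun_scale_in_cont_funs[OF X f], of "1/t" t] by simp
      then show ?thesis using False by (simp add: field_simps)
    qed
  qed
next
  fix f g assume fg: "f \<in> cont_funs X" "g \<in> cont_funs X"
  show "sup_seminorm I N (fun_add (topspace X) f g) \<le> sup_seminorm I N f + sup_seminorm I N g"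
  proof (rule sup_seminorm_le)
    show "0 \<le> sup_seminorm I N f + sup_seminorm I N g"
      using sup_seminorm_nonneg[where N = N and I = I, OF N] fg by (meson add_nonneg_nonneg)
    fix i assume i: "i \<in> I"
    show "N i (fun_add (topspace X) f g) \<le> sup_seminorm I N f + sup_seminorm I N g"
      using lsc_seminorm_triangle[OF N[OF i] fg] le_sup_seminorm[where N = N, OF N _ i] fg
      by (meson add_mono order_trans)
  qed
next
  have eq: "sup_seminorm I N f = (SUP M \<in> insert (\<lambda>_. 0) (N ` I). M f)" for f
    by (simp add: sup_seminorm_def image_image)
  show "lower_semicontinuous_map (pointwise_topology X) (sup_seminorm I N)"
    unfolding eq
  proof (rule lower_semicontinuous_map_Sup)
    fix M assume "M \<in> insert (\<lambda>_. 0) (N ` I)"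
    then show "lower_semicontinuous_map (pointwise_topology X) M"
      using lsc_seminorm_lsc[OF N] by (auto simp: lower_semicontinuous_map_const)
  next
    fix f assume "f \<in> topspace (pointwise_topology X)"
    then have "f \<in> cont_funs X" by (simp add: topspace_pointwise_topology)
    from sup_seminorm_bdd[OF N this]
    show "bdd_above ((\<lambda>M. M f) ` insert (\<lambda>_. 0) (N ` I))" by (simp add: image_image)
  qed auto
qed

lemma lsc_seminorm_cong:
  assumes X: "compact_space X" and N: "lsc_seminorm X c N"
    and eq: "\<And>f. f \<in> cont_funs X \<Longrightarrow> N f = L f"
  shows "lsc_seminorm X c L"
proof -
  have "lower_semicontinuous_map (pointwise_topology X) L"
    using lsc_seminorm_lsc[OF N] eq
    by (rule lower_semicontinuous_map_eq) (simp add: topspace_pointwise_topology)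
  then show ?thesis
    using N eq fun_add_in_cont_funs[OF X] fun_scale_in_cont_funs[OF X]
    unfolding lsc_seminorm_def by (metis (no_types, lifting))
qed

lemma lsc_seminorm_sup_norm:
  assumes X: "compact_space X"
  shows "lsc_seminorm X 1 (sup_norm X)"
proof (rule lsc_seminorm_cong[OF X])
  show *: "lsc_seminorm X 1 (sup_seminorm (topspace X) (\<lambda>x f. \<bar>f x\<bar>))"
    by (rule lsc_seminorm_sup[OF X]) (auto intro: lsc_seminorm_eval)
  fix f assume f: "f \<in> cont_funs X"
  have le: "\<bar>f x\<bar> \<le> sup_seminorm (topspace X) (\<lambda>x f. \<bar>f x\<bar>) f" if "x \<in> topspace X" for x
    by (rule le_sup_seminorm[where N = "\<lambda>x f. \<bar>f x\<bar>"]) (use f that lsc_seminorm_eval in auto)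
  show "sup_seminorm (topspace X) (\<lambda>x f. \<bar>f x\<bar>) f = sup_norm X f"
    using lsc_seminorm_nonneg[OF * f] le f abs_le_sup_norm
    by (intro antisym sup_norm_le sup_seminorm_le) (auto simp: sup_norm_nonneg)
qed

section \<open>Rotundity defects and renorming by countably many seminorms\<close>

text \<open>This quantity tends to \<open>0\<close> along a sequence as in the definition of local uniform rotundity.
  It is nonnegative and additive in the square of the norm, so for a weighted sum of squares of
  seminorms the defect of each of them tends to \<open>0\<close> as well.\<close>

definition rotundity_defect ::
    "'a topology \<Rightarrow> (('a \<Rightarrow> real) \<Rightarrow> real) \<Rightarrow> ('a \<Rightarrow> real) \<Rightarrow> ('a \<Rightarrow> real) \<Rightarrow> real" where
  "rotundity_defect X N f g = 2 * (N f)\<^sup>2 + 2 * (N g)\<^sup>2 - (N (fun_add (topspace X) f g))\<^sup>2"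

lemma rotundity_defect_ge:
  assumes X: "compact_space X" and N: "lsc_seminorm X c N" and fg: "f \<in> cont_funs X" "g \<in> cont_funs X"
  shows "(N f - N g)\<^sup>2 \<le> rotundity_defect X N f g"
proof -
  have "(N (fun_add (topspace X) f g))\<^sup>2 \<le> (N f + N g)\<^sup>2"
    using lsc_seminorm_triangle[OF N fg] lsc_seminorm_nonneg[OF N fun_add_in_cont_funs[OF X fg]]
    by (intro power_mono) auto
  then show ?thesis by (simp add: rotundity_defect_def power2_eq_square algebra_simps)
qed

lemma rotundity_defect_nonneg:
  assumes "compact_space X" "lsc_seminorm X c N" "f \<in> cont_funs X" "g \<in> cont_funs X"
  shows "0 \<le> rotundity_defect X N f g"
  using rotundity_defect_ge[OF assms] by (meson order_trans zero_le_power2)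

lemma rotundity_defect_l2:
  assumes "0 \<le> k"
  shows "rotundity_defect X (\<lambda>f. sqrt ((N f)\<^sup>2 + k * (L f)\<^sup>2)) f g
    = rotundity_defect X N f g + k * rotundity_defect X L f g"
  using assms by (simp add: rotundity_defect_def algebra_simps)

text \<open>Deville's master lemma, in the form needed here: if the defect of a supremum of seminorms is
  small, an index that nearly attains the supremum at \<open>f + g\<close> has small defect, and nearly attains
  the supremum at \<open>f\<close> as well. The second conclusion gives information about the index.\<close>

lemma rotundity_defect_sup:
  assumes X: "compact_space X" and N: "\<And>i. i \<in> I \<Longrightarrow> lsc_seminorm X c (N i)" and "0 \<le> c"
    and fg: "f \<in> cont_funs X" "g \<in> cont_funs X" and "I \<noteq> {}"
    and small: "rotundity_defect X (sup_seminorm I N) f g < \<eta>"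
  obtains i where "i \<in> I" "rotundity_defect X (N i) f g < 2 * \<eta>"
    "(sup_seminorm I N f)\<^sup>2 - \<eta> < (N i f)\<^sup>2"
proof -
  let ?S = "sup_seminorm I N" and ?h = "fun_add (topspace X) f g"
  have h: "?h \<in> cont_funs X" by (rule fun_add_in_cont_funs[OF X fg])
  have S: "lsc_seminorm X c ?S" by (rule lsc_seminorm_sup[OF X N \<open>0 \<le> c\<close>])
  have \<eta>: "0 < \<eta>" using rotundity_defect_nonneg[OF X S fg] small by linarith
  have "\<exists>i\<in>I. (?S ?h)\<^sup>2 - \<eta> < (N i ?h)\<^sup>2"
  proof (rule ccontr)
    assume "\<not> ?thesis"
    then have le: "(N i ?h)\<^sup>2 \<le> (?S ?h)\<^sup>2 - \<eta>" if "i \<in> I" for i using that by force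
    obtain i0 where "i0 \<in> I" using \<open>I \<noteq> {}\<close> by blast
    then have nonneg: "0 \<le> (?S ?h)\<^sup>2 - \<eta>" using le by (meson order_trans zero_le_power2)
    have "?S ?h \<le> sqrt ((?S ?h)\<^sup>2 - \<eta>)"
      using le nonneg by (intro sup_seminorm_le) (auto intro: real_le_rsqrt)
    then have "(?S ?h)\<^sup>2 \<le> (?S ?h)\<^sup>2 - \<eta>"
      using nonneg lsc_seminorm_nonneg[OF S h] by (metis power_mono real_sqrt_pow2)
    then show False using \<eta> by simp
  qed
  then obtain i where i: "i \<in> I" and near: "(?S ?h)\<^sup>2 - \<eta> < (N i ?h)\<^sup>2" by blast
  have le: "(N i u)\<^sup>2 \<le> (?S u)\<^sup>2" if "u \<in> cont_funs X" for u
    using le_sup_seminorm[where N = N, OF N that i] lsc_seminorm_nonneg[OF N[OF i] that] by (simp add: power_mono)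
  have "0 \<le> rotundity_defect X (N i) f g" by (rule rotundity_defect_nonneg[OF X N[OF i] fg])
  then show thesis
    using that[OF i] near small le[OF fg(1)] le[OF fg(2)] by (simp add: rotundity_defect_def)
qed

text \<open>The norm is the square root of the weighted sum of the squares of an enumeration of \<open>\<N>\<close>. Its
  defect dominates a multiple of the defect of each member, so that local uniform rotundity
  only has to be proved for all the members of \<open>\<N>\<close> jointly.\<close>

lemma renorming_criterion:
  assumes X: "compact_space X" and "countable \<N>"
    and N: "\<And>N. N \<in> \<N> \<Longrightarrow> lsc_seminorm X c N" and sn: "sup_norm X \<in> \<N>"
    and conv: "\<And>f F. f \<in> cont_funs X \<Longrightarrow> (\<And>r. F r \<in> cont_funs X) \<Longrightarrow>
      (\<And>N. N \<in> \<N> \<Longrightarrow> (\<lambda>r. rotundity_defect X N f (F r)) \<longlonglongrightarrow> 0) \<Longrightarrow>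
      (\<lambda>r. sup_norm X (fun_diff (topspace X) f (F r))) \<longlonglongrightarrow> 0"
  shows "\<exists>\<nu>. norm_on (topspace X) (cont_funs X) \<nu> \<and>
             equivalent_norms_on (cont_funs X) (sup_norm X) \<nu> \<and>
             lower_semicontinuous_map (pointwise_topology X) \<nu> \<and>
             locally_uniformly_rotund_on (topspace X) (cont_funs X) \<nu>"
proof -
  let ?S = "topspace X" and ?C = "cont_funs X"
  define e where "e = from_nat_into \<N>"
  have e: "lsc_seminorm X c (e k)" for k
    unfolding e_def using from_nat_into[of \<N> k] sn by (intro N) auto
  have surj: "\<exists>k. e k = N" if "N \<in> \<N>" for N
    unfolding e_def using from_nat_into_surj[OF \<open>countable \<N>\<close> that] by blast
  define T where "T f k = (e k f)\<^sup>2 / 2 ^ k" for f and k :: nat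
  define \<nu> where "\<nu> f = sqrt (suminf (T f))" for f
  have Tnn: "0 \<le> T f k" for f k by (simp add: T_def)
  have geo: "(\<lambda>k. x * (1/2) ^ k) sums (2 * x)" for x :: real
    using sums_mult[OF geometric_sums[of "1/2 :: real"], of x] by (simp add: mult.commute)
  have Tle: "T f k \<le> (c * sup_norm X f)\<^sup>2 * (1/2) ^ k" if "f \<in> ?C" for f k
    using power_mono[OF lsc_seminorm_le[OF e that, of k] lsc_seminorm_nonneg[OF e that, of k], of 2]
    by (simp add: T_def power_one_over divide_simps)
  have Tsum: "summable (T f)" if "f \<in> ?C" for f
    by (rule summable_comparison_test'[OF sums_summable[OF geo], where N = 0])
      (use Tle[OF that] Tnn in auto)
  have nu2: "(\<nu> f)\<^sup>2 = suminf (T f)" if "f \<in> ?C" for f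
    using Tsum[OF that] Tnn by (simp add: \<nu>_def suminf_nonneg)
  have nunn: "0 \<le> \<nu> f" if "f \<in> ?C" for f
    using Tsum[OF that] Tnn by (simp add: \<nu>_def suminf_nonneg)
  have nu_ge: "T f k \<le> (\<nu> f)\<^sup>2" if "f \<in> ?C" for f k
    unfolding nu2[OF that] using sum_le_suminf[OF Tsum[OF that], of "{k}"] Tnn by simp
  have nu_le: "\<nu> f \<le> 2 * (\<bar>c\<bar> * sup_norm X f)" if "f \<in> ?C" for f
  proof (rule power2_le_imp_le)
    have "(\<nu> f)\<^sup>2 \<le> 2 * (c * sup_norm X f)\<^sup>2"
      unfolding nu2[OF that] by (rule sums_le[OF Tle[OF that] summable_sums[OF Tsum[OF that]] geo])
    also have "\<dots> \<le> (2 * (\<bar>c\<bar> * sup_norm X f))\<^sup>2"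
      by (simp add: power_mult_distrib)
    finally show "(\<nu> f)\<^sup>2 \<le> (2 * (\<bar>c\<bar> * sup_norm X f))\<^sup>2" .
  qed (simp add: sup_norm_nonneg)
  have nu_scale: "\<nu> (fun_scale ?S t f) = \<bar>t\<bar> * \<nu> f" if "f \<in> ?C" for t f
  proof -
    have "T (fun_scale ?S t f) = (\<lambda>k. t\<^sup>2 * T f k)"
      by (auto simp: T_def lsc_seminorm_scale[OF e that] power_mult_distrib)
    then have "suminf (T (fun_scale ?S t f)) = t\<^sup>2 * suminf (T f)"
      by (simp add: suminf_mult[OF Tsum[OF that]])
    then show ?thesis by (simp add: \<nu>_def real_sqrt_mult)
  qed
  have nu_tri: "\<nu> (fun_add ?S f g) \<le> \<nu> f + \<nu> g" if fg: "f \<in> ?C" "g \<in> ?C" for f g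
  proof -
    have h: "fun_add ?S f g \<in> ?C" by (rule fun_add_in_cont_funs[OF X fg])
    have L2: "sqrt (\<Sum>k<n. T u k) = L2_set (\<lambda>k. e k u / sqrt (2 ^ k)) {..<n}" for u n
      by (simp add: L2_set_def T_def power_divide)
    have le: "sqrt (\<Sum>k<n. T (fun_add ?S f g) k) \<le> sqrt (\<Sum>k<n. T f k) + sqrt (\<Sum>k<n. T g k)" for n
    proof -
      have "L2_set (\<lambda>k. e k (fun_add ?S f g) / sqrt (2 ^ k)) {..<n}
        \<le> L2_set (\<lambda>k. e k f / sqrt (2 ^ k) + e k g / sqrt (2 ^ k)) {..<n}"
        using lsc_seminorm_triangle[OF e fg] lsc_seminorm_nonneg[OF e h]
        by (intro L2_set_mono) (auto simp flip: add_divide_distrib intro!: divide_right_mono)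
      also have "\<dots> \<le> L2_set (\<lambda>k. e k f / sqrt (2 ^ k)) {..<n} + L2_set (\<lambda>k. e k g / sqrt (2 ^ k)) {..<n}"
        by (rule L2_set_triangle_ineq)
      finally show ?thesis by (simp add: L2)
    qed
    have lim: "(\<lambda>n. sqrt (\<Sum>k<n. T u k)) \<longlonglongrightarrow> \<nu> u" if "u \<in> ?C" for u
      unfolding \<nu>_def by (intro tendsto_real_sqrt summable_LIMSEQ Tsum that)
    show ?thesis
      by (rule LIMSEQ_le[OF lim[OF h] tendsto_add[OF lim[OF fg(1)] lim[OF fg(2)]]]) (use le in auto)
  qed
  obtain k0 where k0: "e k0 = sup_norm X" using surj[OF sn] by blast
  have nu_lower: "(1 / sqrt (2 ^ k0)) * sup_norm X f \<le> \<nu> f" if "f \<in> ?C" for f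
    by (rule power2_le_imp_le)
      (use nu_ge[OF that, of k0] nunn[OF that] in \<open>auto simp: T_def k0 power_divide\<close>)
  have nu_lsc: "lower_semicontinuous_map (pointwise_topology X) \<nu>"
  proof -
    have part: "lower_semicontinuous_map (pointwise_topology X) (\<lambda>f. \<Sum>k<n. T f k)" for n
    proof (induction n)
      case (Suc n)
      have "lower_semicontinuous_map (pointwise_topology X) (\<lambda>f. (1 / 2 ^ n) * (e n f)\<^sup>2)"
        by (intro lower_semicontinuous_map_cmul lower_semicontinuous_map_power2 lsc_seminorm_lsc[OF e])
          (auto simp: topspace_pointwise_topology lsc_seminorm_nonneg[OF e])
      then show ?case using lower_semicontinuous_map_add[OF Suc] by (simp add: T_def)
    qed (simp add: lower_semicontinuous_map_const)
    have bdd: "bdd_above (range (\<lambda>n. \<Sum>k<n. T f k))" if "f \<in> ?C" for f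
      using sum_le_suminf[OF Tsum[OF that]] Tnn by (auto simp: bdd_above_def)
    have "lower_semicontinuous_map (pointwise_topology X) (\<lambda>f. SUP n. \<Sum>k<n. T f k)"
      by (rule lower_semicontinuous_map_Sup) (use part bdd in \<open>auto simp: topspace_pointwise_topology\<close>)
    then have "lower_semicontinuous_map (pointwise_topology X) (\<lambda>f. suminf (T f))"
      by (rule lower_semicontinuous_map_eq)
        (auto simp: topspace_pointwise_topology suminf_eq_SUP_real Tsum Tnn)
    then show ?thesis
      unfolding \<nu>_def using suminf_nonneg[OF Tsum] Tnn
      by (intro lower_semicontinuous_map_sqrt) (auto simp: topspace_pointwise_topology)
  qed
  have defect: "rotundity_defect X (e k) f g / 2 ^ k \<le> rotundity_defect X \<nu> f g"
    if fg: "f \<in> ?C" "g \<in> ?C" for f g k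
  proof -
    have h: "fun_add ?S f g \<in> ?C" by (rule fun_add_in_cont_funs[OF X fg])
    let ?R = "\<lambda>k. rotundity_defect X (e k) f g / 2 ^ k"
    have R: "?R = (\<lambda>k. 2 * T f k + 2 * T g k - T (fun_add ?S f g) k)"
      by (auto simp: rotundity_defect_def T_def add_divide_distrib diff_divide_distrib)
    have "(\<lambda>k. 2 * T f k + 2 * T g k - T (fun_add ?S f g) k) sums
        (2 * suminf (T f) + 2 * suminf (T g) - suminf (T (fun_add ?S f g)))"
      by (intro sums_diff sums_add sums_mult summable_sums Tsum fg h)
    then have sums: "?R sums rotundity_defect X \<nu> f g"
      unfolding R by (simp only: rotundity_defect_def nu2[OF fg(1)] nu2[OF fg(2)] nu2[OF h])
    then have "sum ?R {k} \<le> suminf ?R"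
      using rotundity_defect_nonneg[OF X e fg] by (intro sum_le_suminf) (auto simp: sums_iff)
    then show ?thesis using sums by (simp add: sums_iff)
  qed
  show ?thesis
  proof (intro exI conjI)
    show "norm_on ?S ?C \<nu>"
      unfolding norm_on_def
    proof (intro conjI ballI allI)
      fix f assume f: "f \<in> ?C"
      show "\<nu> f = 0 \<longleftrightarrow> f = fun_zero ?S"
      proof
        assume "\<nu> f = 0"
        then have "sup_norm X f \<le> 0" using nu_lower[OF f] by (simp add: divide_simps)
        then have "f x = 0" if "x \<in> ?S" for x using abs_le_sup_norm[OF f that] by simp
        moreover have "f \<in> extensional ?S" using f by (simp add: cont_funs_def)
        ultimately show "f = fun_zero ?S" by (auto simp: fun_zero_def extensional_def)
      next
        assume "f = fun_zero ?S"
        then have "f = fun_scale ?S 0 f" by (auto simp: fun_zero_def fun_scale_def)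
        then show "\<nu> f = 0" using nu_scale[OF f, of 0] by simp
      qed
    qed (use nunn nu_scale nu_tri in auto)
    show "equivalent_norms_on ?C (sup_norm X) \<nu>"
      unfolding equivalent_norms_on_def
    proof (intro exI conjI ballI)
      fix f assume f: "f \<in> ?C"
      show "(1 / sqrt (2 ^ k0)) * sup_norm X f \<le> \<nu> f" by (rule nu_lower[OF f])
      show "\<nu> f \<le> (2 * \<bar>c\<bar> + 1) * sup_norm X f"
        using nu_le[OF f] sup_norm_nonneg[of X f] by (simp add: algebra_simps)
    qed auto
    show "lower_semicontinuous_map (pointwise_topology X) \<nu>" by (rule nu_lsc)
    show "locally_uniformly_rotund_on ?S ?C \<nu>"
      unfolding locally_uniformly_rotund_on_def
    proof (intro ballI allI impI)
      fix f F
      assume f: "f \<in> ?C" and "\<forall>n. F n \<in> ?C"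
        and lim: "(\<lambda>n. \<nu> (F n)) \<longlonglongrightarrow> \<nu> f"
        and lim2: "(\<lambda>n. \<nu> (fun_scale ?S (1/2) (fun_add ?S f (F n)))) \<longlonglongrightarrow> \<nu> f"
      then have F: "F n \<in> ?C" for n by blast
      have "(\<lambda>n. 2 * \<nu> (fun_scale ?S (1/2) (fun_add ?S f (F n)))) \<longlonglongrightarrow> 2 * \<nu> f"
        by (intro tendsto_intros lim2)
      then have "(\<lambda>n. \<nu> (fun_add ?S f (F n))) \<longlonglongrightarrow> 2 * \<nu> f"
        by (simp add: nu_scale fun_add_in_cont_funs[OF X f F])
      then have "(\<lambda>n. rotundity_defect X \<nu> f (F n)) \<longlonglongrightarrow> 2 * (\<nu> f)\<^sup>2 + 2 * (\<nu> f)\<^sup>2 - (2 * \<nu> f)\<^sup>2"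
        unfolding rotundity_defect_def by (intro tendsto_intros lim)
      then have D: "(\<lambda>n. rotundity_defect X \<nu> f (F n)) \<longlonglongrightarrow> 0" by (simp add: power_mult_distrib)
      have "(\<lambda>n. rotundity_defect X N f (F n)) \<longlonglongrightarrow> 0" if mem: "N \<in> \<N>" for N
      proof -
        obtain k where k: "e k = N" using surj[OF mem] by blast
        show ?thesis
        proof (rule tendsto_sandwich[OF _ _ tendsto_const])
          show "(\<lambda>n. 2 ^ k * rotundity_defect X \<nu> f (F n)) \<longlonglongrightarrow> 0"
            using tendsto_mult[OF tendsto_const D, of "2 ^ k"] by simp
          show "\<forall>\<^sub>F n in sequentially. 0 \<le> rotundity_defect X N f (F n)"
            using rotundity_defect_nonneg[OF X e f F] k by auto
          show "\<forall>\<^sub>F n in sequentially. rotundity_defect X N f (F n) \<le> 2 ^ k * rotundity_defect X \<nu> f (F n)"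
            using defect[OF f F, of k] k by (auto simp: field_simps)
        qed
      qed
      then have conv0: "(\<lambda>n. sup_norm X (fun_diff ?S f (F n))) \<longlonglongrightarrow> 0" by (rule conv[OF f F])
      show "(\<lambda>n. \<nu> (fun_diff ?S f (F n))) \<longlonglongrightarrow> 0"
      proof (rule tendsto_sandwich[OF _ _ tendsto_const])
        show "(\<lambda>n. 2 * (\<bar>c\<bar> * sup_norm X (fun_diff ?S f (F n)))) \<longlonglongrightarrow> 0"
          using tendsto_mult[OF tendsto_const conv0, of "2 * \<bar>c\<bar>"] by (simp add: mult.assoc)
      qed (use nunn nu_le fun_diff_in_cont_funs[OF X f F] in auto)
    qed
  qed
qed

section \<open>Polish spaces\<close>

lemma polish_topology_countable_base:
  assumes "polish_topology \<Gamma>"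
  obtains b :: "nat \<Rightarrow> 'g set" where "\<And>n. openin \<Gamma> (b n)"
    "\<And>U x. openin \<Gamma> U \<Longrightarrow> x \<in> U \<Longrightarrow> \<exists>n. x \<in> b n \<and> b n \<subseteq> U"
proof -
  obtain C where C: "countable C" "C \<subseteq> topspace \<Gamma>" "\<Gamma> closure_of C = topspace \<Gamma>"
    using assms by (auto simp: polish_topology_def separable_space_def)
  obtain S d where "Metric_space S d" and \<Gamma>: "\<Gamma> = Metric_space.mtopology S d"
    using assms by (auto simp: polish_topology_def completely_metrizable_space_def)
  then interpret Metric_space S d by simp
  define \<B> where "\<B> = insert {} ((\<lambda>(c, n). mball c (1 / real (Suc n))) ` (C \<times> UNIV))"
  have "countable \<B>" using C(1) by (auto simp: \<B>_def)
  have "\<exists>V\<in>\<B>. x \<in> V \<and> V \<subseteq> U" if "openin \<Gamma> U" "x \<in> U" for U x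
  proof -
    obtain r where r: "r > 0" "mball x r \<subseteq> U" and xS: "x \<in> S"
      using \<open>openin \<Gamma> U\<close> \<open>x \<in> U\<close> unfolding \<Gamma> openin_mtopology by blast
    obtain n where n: "1 / real (Suc n) < r / 2"
      using nat_approx_posE[of "r/2"] r(1) by auto
    have "x \<in> mtopology closure_of C" using C(3) xS by (simp add: \<Gamma>)
    moreover have "0 < 1 / real (Suc n)" by simp
    ultimately obtain c where c: "c \<in> C" "c \<in> mball x (1 / real (Suc n))"
      unfolding metric_closure_of by blast
    have "x \<in> mball c (1 / real (Suc n))" using c by (simp add: commute)
    moreover have "mball c (1 / real (Suc n)) \<subseteq> mball x r"
    proof
      fix y assume y: "y \<in> mball c (1 / real (Suc n))"
      then have "d x y < r"
        using c n triangle[of x c y] by auto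
      then show "y \<in> mball x r" using y xS by simp
    qed
    ultimately show ?thesis using r(2) c(1) unfolding \<B>_def by (intro bexI[of _ "mball c (1 / real (Suc n))"]) auto
  qed
  moreover have "openin \<Gamma> V" if "V \<in> \<B>" for V
    using that by (auto simp: \<B>_def \<Gamma>)
  moreover have "\<B> \<noteq> {}" by (simp add: \<B>_def)
  ultimately have open_\<B>: "openin \<Gamma> (from_nat_into \<B> n)"
    and base: "openin \<Gamma> U \<Longrightarrow> x \<in> U \<Longrightarrow> \<exists>V\<in>\<B>. x \<in> V \<and> V \<subseteq> U" for n U x
    using from_nat_into[of \<B>] by auto
  have "\<exists>n. x \<in> from_nat_into \<B> n \<and> from_nat_into \<B> n \<subseteq> U" if "openin \<Gamma> U" "x \<in> U" for U x
    using base[OF that] from_nat_into_surj[OF \<open>countable \<B>\<close>] by metis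
  with open_\<B> show thesis by (rule that)
qed

text \<open>Without an isolated point the set would be perfect, and a nonempty perfect set in a completely
  metrizable space has the cardinality of the continuum.\<close>

lemma countable_closedin_isolated_point:
  assumes "completely_metrizable_space \<Gamma>" "closedin \<Gamma> A" "countable A" "A \<noteq> {}"
  obtains U x where "openin \<Gamma> U" "U \<inter> A = {x}"
proof -
  have "\<Gamma> derived_set_of A \<noteq> A"
  proof
    assume "\<Gamma> derived_set_of A = A"
    then have "(UNIV :: real set) \<lesssim> A" using assms by (intro lepoll_perfect_set) auto
    then show False
      using \<open>countable A\<close> uncountable_UNIV_real countable_lepoll by blast
  qed
  moreover have "\<Gamma> derived_set_of A \<subseteq> A"
    using assms(2) by (simp add: closedin_contains_derived_set)
  ultimately obtain x where x: "x \<in> A" "x \<notin> \<Gamma> derived_set_of A" by blast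
  then obtain U where "openin \<Gamma> U" "x \<in> U" "\<And>y. y \<noteq> x \<Longrightarrow> y \<in> A \<Longrightarrow> y \<notin> U"
    using closedin_subset[OF assms(2)] unfolding in_derived_set_of by blast
  then show thesis using that[of U x] x by blast
qed

text \<open>Besides \<open>\<Gamma>\<close> and \<open>K\<close> the countable sets that separability provides are fixed: a dense set \<open>Q\<close> and a
  base \<open>b\<close> of \<open>\<Gamma>\<close>, and a dense set \<open>D\<close> of \<open>K\<close>.\<close>

locale compactum_with_countable_discontinuities =
  fixes \<Gamma> :: "'g topology" and K :: "('g \<Rightarrow> real) set" and Q :: "'g set"
    and b :: "nat \<Rightarrow> 'g set" and D :: "('g \<Rightarrow> real) set"
  assumes metrizable: "completely_metrizable_space \<Gamma>"
    and K_sub: "K \<subseteq> topspace \<Gamma> \<rightarrow>\<^sub>E UNIV"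
    and compact_K: "compact_space (subtopology (powertop_real (topspace \<Gamma>)) K)"
    and discont: "\<And>s. s \<in> K \<Longrightarrow> countable (discontinuities \<Gamma> s)"
    and Q: "countable Q" "Q \<subseteq> topspace \<Gamma>" "\<Gamma> closure_of Q = topspace \<Gamma>"
    and b_open: "\<And>n. openin \<Gamma> (b n)"
    and b_base: "\<And>U x. openin \<Gamma> U \<Longrightarrow> x \<in> U \<Longrightarrow> \<exists>n. x \<in> b n \<and> b n \<subseteq> U"
    and D: "countable D" "D \<subseteq> K" "subtopology (powertop_real (topspace \<Gamma>)) K closure_of D = K"
begin

abbreviation "G \<equiv> topspace \<Gamma>"
abbreviation "X \<equiv> subtopology (powertop_real G) K"

lemma topspace_X: "topspace X = K"
  using K_sub by auto

lemma b_sub: "b n \<subseteq> G"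
  using b_open openin_subset by blast

section \<open>Pairs of functions in the compactum\<close>

definition gap :: "('g \<Rightarrow> real) \<times> ('g \<Rightarrow> real) \<Rightarrow> 'g \<Rightarrow> real" where
  "gap p \<gamma> = \<bar>fst p \<gamma> - snd p \<gamma>\<bar>"

definition osc :: "('g \<Rightarrow> real) \<times> ('g \<Rightarrow> real) \<Rightarrow> (('g \<Rightarrow> real) \<Rightarrow> real) \<Rightarrow> real" where
  "osc p f = \<bar>f (fst p) - f (snd p)\<bar>"

definition near :: "real \<Rightarrow> 'g set \<Rightarrow> (('g \<Rightarrow> real) \<times> ('g \<Rightarrow> real)) set" where
  "near c B = {p \<in> K \<times> K. \<forall>\<gamma>\<in>B. gap p \<gamma> \<le> c}"

definition apart :: "real \<Rightarrow> ('g \<Rightarrow> real) \<times> ('g \<Rightarrow> real) \<Rightarrow> 'g set" where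
  "apart c p = {\<gamma> \<in> G. c < gap p \<gamma>}"

text \<open>The factor between the two tolerances matters: where \<open>s\<close> and \<open>t\<close> differ by more than \<open>\<delta>\<close> although they
  differ by at most \<open>\<delta> / 2\<close> on the dense set \<open>Q\<close>, one of them is discontinuous, and this persists for
  accumulation points.\<close>

definition close_pairs :: "real \<Rightarrow> 'g set \<Rightarrow> (('g \<Rightarrow> real) \<times> ('g \<Rightarrow> real)) set" where
  "close_pairs \<delta> B = near (\<delta> / 2) Q \<inter> near \<delta> B"

definition base_union :: "nat list \<Rightarrow> 'g set" where
  "base_union v = (\<Union>i\<in>set v. b i)"

text \<open>Finite parts of \<open>Q\<close>: a seminorm that only involves these leaves room for a finite net in \<open>K\<close>.\<close>

definition Q_part :: "nat \<Rightarrow> 'g set" where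
  "Q_part n = {\<gamma> \<in> Q. to_nat_on Q \<gamma> < n}"

lemma finite_Q_part: "finite (Q_part n)"
proof -
  have "inj_on (to_nat_on Q) (Q_part n)"
    using Q(1) by (auto simp: Q_part_def intro: inj_on_subset[OF inj_on_to_nat_on])
  moreover have "finite (to_nat_on Q ` Q_part n)"
    by (rule finite_subset[of _ "{..<n}"]) (auto simp: Q_part_def)
  ultimately show ?thesis by (rule finite_imageD[rotated])
qed

lemma Q_part_mono: "m \<le> n \<Longrightarrow> Q_part m \<subseteq> Q_part n"
  by (auto simp: Q_part_def)

lemma Q_eq_Union: "Q = (\<Union>n. Q_part n)"
  by (auto simp: Q_part_def)

lemma near_antimono: "A \<subseteq> B \<Longrightarrow> near c B \<subseteq> near c A"
  by (auto simp: near_def)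

lemma close_pairs_antimono: "A \<subseteq> B \<Longrightarrow> close_pairs \<delta> B \<subseteq> close_pairs \<delta> A"
  using near_antimono unfolding close_pairs_def by blast

lemma continuous_map_gap:
  assumes "\<gamma> \<in> G"
  shows "continuous_map (prod_topology X X) euclideanreal (\<lambda>p. gap p \<gamma>)"
proof -
  have "continuous_map X euclideanreal (\<lambda>s. s \<gamma>)"
    using assms by (intro continuous_map_from_subtopology continuous_map_product_projection)
  then have "continuous_map (prod_topology X X) euclideanreal (\<lambda>p. fst p \<gamma>)"
    "continuous_map (prod_topology X X) euclideanreal (\<lambda>p. snd p \<gamma>)"
    using continuous_map_compose[OF continuous_map_fst, unfolded o_def]
      continuous_map_compose[OF continuous_map_snd, unfolded o_def] by blast+
  then show ?thesis unfolding gap_def by (intro continuous_intros)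
qed

lemma closedin_gap_le:
  assumes "\<gamma> \<in> G"
  shows "closedin (prod_topology X X) {p \<in> K \<times> K. gap p \<gamma> \<le> c}"
proof -
  have "closedin (prod_topology X X) {p \<in> topspace (prod_topology X X). gap p \<gamma> \<in> {..c}}"
    by (rule closedin_continuous_map_preimage[OF continuous_map_gap[OF assms]]) auto
  then show ?thesis by (simp add: topspace_X del: topspace_subtopology)
qed

lemma closedin_near:
  assumes "B \<subseteq> G"
  shows "closedin (prod_topology X X) (near c B)"
proof (cases "B = {}")
  case True
  have "closedin (prod_topology X X) (topspace (prod_topology X X))" by blast
  then show ?thesis using True by (simp add: topspace_X near_def del: topspace_subtopology)
next
  case False
  then have "near c B = (\<Inter>\<gamma>\<in>B. {p \<in> K \<times> K. gap p \<gamma> \<le> c})" by (auto simp: near_def)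
  then show ?thesis using closedin_gap_le assms False by (auto intro!: closedin_INT)
qed

lemma closedin_close_pairs:
  "B \<subseteq> G \<Longrightarrow> closedin (prod_topology X X) (close_pairs \<delta> B)"
  using Q(2) by (simp add: close_pairs_def closedin_Int closedin_near)

lemma closedin_osc_ge:
  assumes "f \<in> cont_funs X"
  shows "closedin (prod_topology X X) {p \<in> K \<times> K. a \<le> osc p f}"
proof -
  have "continuous_map X euclideanreal f" using assms by (simp add: cont_funs_def)
  then have "continuous_map (prod_topology X X) euclideanreal (\<lambda>p. f (fst p))"
    "continuous_map (prod_topology X X) euclideanreal (\<lambda>p. f (snd p))"
    using continuous_map_compose[OF continuous_map_fst, unfolded o_def]
      continuous_map_compose[OF continuous_map_snd, unfolded o_def] by blast+
  then have "continuous_map (prod_topology X X) euclideanreal (\<lambda>p. osc p f)"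
    unfolding osc_def by (intro continuous_intros)
  then have "closedin (prod_topology X X) {p \<in> topspace (prod_topology X X). osc p f \<in> {a..}}"
    by (rule closedin_continuous_map_preimage) auto
  then show ?thesis by (simp add: topspace_X del: topspace_subtopology)
qed

text \<open>Every use of the compactness of \<open>K \<times> K\<close> below goes through this form of it.\<close>

lemma decseq_closed_pairs_nonempty:
  fixes C :: "nat \<Rightarrow> (('g \<Rightarrow> real) \<times> ('g \<Rightarrow> real)) set"
  assumes "\<And>n. closedin (prod_topology X X) (C n)" "\<And>n. C n \<noteq> {}" "\<And>n. C (Suc n) \<subseteq> C n"
  obtains p where "\<And>n. p \<in> C n"
proof -
  have "compact_space (prod_topology X X)"
    using compact_K by (simp add: compact_space_prod_topology)
  moreover have "decseq C" using assms(3) by (rule decseq_SucI)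
  ultimately have "(\<Inter>n. C n) \<noteq> {}"
    using assms(1,2) by (intro compact_space_imp_nest)
  then show thesis using that by blast
qed

text \<open>Uniform continuity: pairs that are close on all of \<open>\<Gamma>\<close> and on which \<open>f\<close> oscillates by \<open>a\<close> would
  accumulate at a pair \<open>(s, s)\<close> of the diagonal.\<close>

lemma osc_small_of_near:
  assumes f: "f \<in> cont_funs X" and "0 < a"
  obtains e :: nat where "\<And>p. p \<in> near (1 / Suc e) G \<Longrightarrow> osc p f < a"
proof (rule ccontr)
  assume "\<not> thesis"
  then have ex: "\<exists>p. p \<in> near (1 / Suc e) G \<and> a \<le> osc p f" for e
    using that by (meson not_less)
  let ?C = "\<lambda>n. near (1 / Suc n) G \<inter> {p \<in> K \<times> K. a \<le> osc p f}"
  obtain p where p: "p \<in> ?C n" for n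
  proof (rule decseq_closed_pairs_nonempty[of ?C])
    show "?C n \<noteq> {}" for n using ex[of n] by (auto simp: near_def)
    show "?C (Suc n) \<subseteq> ?C n" for n
    proof -
      have "1 / real (Suc (Suc n)) \<le> 1 / real (Suc n)" by (simp add: field_simps)
      then show ?thesis unfolding near_def by (auto intro: order_trans)
    qed
  qed (use f closedin_near closedin_osc_ge in \<open>auto intro!: closedin_Int\<close>)
  have "fst p \<gamma> = snd p \<gamma>" if "\<gamma> \<in> G" for \<gamma>
  proof (rule ccontr)
    assume "fst p \<gamma> \<noteq> snd p \<gamma>"
    then obtain n where "1 / real (Suc n) < gap p \<gamma>"
      using nat_approx_posE[of "gap p \<gamma>"] by (auto simp: gap_def)
    then show False using p[of n] that by (force simp: near_def)
  qed
  moreover have "fst p \<in> K" "snd p \<in> K" using p[of 0] by (auto simp: near_def)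
  ultimately have "fst p = snd p" using K_sub by (intro PiE_ext[of "fst p" G "\<lambda>_. UNIV"]) auto
  then show False using p[of 0] \<open>0 < a\<close> by (simp add: osc_def)
qed

section \<open>Seminorms that detect points\<close>

text \<open>The seminorms from which the norm is built. The empty list gives the oscillation of \<open>f\<close> that the
  finite set \<open>M\<close> (with a finite part of \<open>Q\<close>) fails to control. An instruction \<open>(v, u, l)\<close> looks for a further point
  of \<open>\<Gamma>\<close>: the admissible pairs are those that are \<open>\<delta>\<close>-close on \<open>M\<close> and on the basic open sets numbered by
  \<open>v\<close>, and that are \<open>\<delta>\<close>-apart at exactly one point of \<open>b u\<close>. This point is added to \<open>M\<close> and the remaining
  instructions are followed. The points range over an uncountable set, but there are only countably many lists of
  instructions. The weight \<open>1 / (l + 2)\<close> lets \<open>osc p f\<close> dominate the choice of the pair; it is at most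
  \<open>1/2\<close>, which keeps all these seminorms bounded by \<open>4\<close> times the supremum norm.\<close>

primrec \<Theta> :: "real \<Rightarrow> (nat list \<times> nat \<times> nat) list \<Rightarrow> nat \<Rightarrow> 'g set \<Rightarrow>
    (('g \<Rightarrow> real) \<Rightarrow> real) \<Rightarrow> real" where
  "\<Theta> \<delta> [] = (\<lambda>n M. sup_seminorm (near (\<delta> / 2) (Q_part n) \<inter> near \<delta> M) osc)"
| "\<Theta> \<delta> (\<pi> # \<pi>s) = (\<lambda>n M. case \<pi> of (v, u, l) \<Rightarrow>
     sup_seminorm {p \<in> close_pairs \<delta> (M \<union> base_union v). \<exists>\<gamma>. apart \<delta> p \<inter> b u = {\<gamma>}}
       (\<lambda>p f. sqrt ((osc p f)\<^sup>2 +
          1 / real (l + 2) * (\<Theta> \<delta> \<pi>s n (insert (the_elem (apart \<delta> p \<inter> b u)) M) f)\<^sup>2)))"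

lemma lsc_seminorm_osc: "p \<in> K \<times> K \<Longrightarrow> lsc_seminorm X 2 (osc p)"
  unfolding osc_def by (rule lsc_seminorm_diff) (auto simp: topspace_X simp del: topspace_subtopology)

lemma close_pairs_sub: "close_pairs \<delta> B \<subseteq> K \<times> K"
  by (auto simp: close_pairs_def near_def)

lemma lsc_seminorm_summand:
  assumes "p \<in> K \<times> K" "lsc_seminorm X 4 L"
  shows "lsc_seminorm X 4 (\<lambda>f. sqrt ((osc p f)\<^sup>2 + 1 / real (l + 2) * (L f)\<^sup>2))"
  by (rule lsc_seminorm_l2[OF compact_K lsc_seminorm_osc[OF assms(1)] assms(2)])
    (auto simp: divide_simps)

lemma lsc_seminorm_Theta: "lsc_seminorm X 4 (\<Theta> \<delta> \<pi>s n M)"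
proof (induction \<pi>s arbitrary: M)
  case Nil
  have "lsc_seminorm X 2 (sup_seminorm (near (\<delta> / 2) (Q_part n) \<inter> near \<delta> M) osc)"
    by (rule lsc_seminorm_sup[OF compact_K]) (auto simp: near_def intro!: lsc_seminorm_osc)
  then show ?case by (auto elim: lsc_seminorm_mono)
next
  case (Cons \<pi> \<pi>s)
  obtain v u l where \<pi>: "\<pi> = (v, u, l)" by (cases \<pi>)
  have "p \<in> K \<times> K" if "p \<in> close_pairs \<delta> B" for p B
    using that close_pairs_sub by blast
  then show ?case
    unfolding \<pi> \<Theta>.simps prod.case
    by (intro lsc_seminorm_sup[OF compact_K] lsc_seminorm_summand Cons) auto
qed

text \<open>The property of a finite set \<open>M\<close> that the rotundity of the norm yields for the sequence \<open>F\<close>. It is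
  known for the empty set, and is extended to larger sets point by point.\<close>

definition pinned where
  "pinned \<delta> f F M \<longleftrightarrow> (\<forall>\<pi>s n. (\<lambda>r. rotundity_defect X (\<Theta> \<delta> \<pi>s n M) f (F r)) \<longlonglongrightarrow> 0)"

text \<open>The point \<open>\<gamma>\<close> can be found from \<open>f\<close>, given \<open>M\<close> and the instruction: some admissible pair of oscillation at
  least \<open>a\<close> singles out \<open>\<gamma>\<close>, and all pairs whose oscillation is not much smaller are apart at \<open>\<gamma>\<close>.\<close>

definition detects where
  "detects \<delta> a f M v u \<gamma> \<longleftrightarrow>
     (\<exists>p \<in> close_pairs \<delta> (M \<union> base_union v). apart \<delta> p \<inter> b u = {\<gamma>} \<and> a \<le> osc p f) \<and>
     (\<exists>a'<a. \<forall>p \<in> close_pairs \<delta> (M \<union> base_union v). a' \<le> osc p f \<longrightarrow> \<gamma> \<in> apart \<delta> p)"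

text \<open>An index pair that nearly attains the supremum in \<open>\<Theta>\<close> has oscillation close to \<open>a\<close>, provided that \<open>l\<close> is large;
  as \<open>\<gamma>\<close> is detected, the unique point of \<open>b u\<close> where this pair is apart must be \<open>\<gamma>\<close>. Hence the seminorm
  attached to the pair is the one for \<open>insert \<gamma> M\<close>, whatever the member of the sequence, and its defect is small.\<close>

lemma pinned_insert:
  assumes f: "f \<in> cont_funs X" and F: "\<And>r. F r \<in> cont_funs X" and "0 < a"
    and M: "pinned \<delta> f F M" and det: "detects \<delta> a f M v u \<gamma>"
  shows "pinned \<delta> f F (insert \<gamma> M)"
  unfolding pinned_def
proof (intro allI)
  fix \<pi>s n
  obtain p0 where p0: "p0 \<in> close_pairs \<delta> (M \<union> base_union v)" "apart \<delta> p0 \<inter> b u = {\<gamma>}" "a \<le> osc p0 f"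
    using det by (auto simp: detects_def)
  obtain a' where "a' < a" and a': "\<And>p. p \<in> close_pairs \<delta> (M \<union> base_union v) \<Longrightarrow> a' \<le> osc p f \<Longrightarrow> \<gamma> \<in> apart \<delta> p"
    using det by (auto simp: detects_def)
  \<comment> \<open>Squares of oscillations are compared, so the threshold is made nonnegative.\<close>
  define c where "c = max 0 a'"
  define \<eta> where "\<eta> = (a\<^sup>2 - c\<^sup>2) / 2"
  have "0 \<le> c" "c < a" using \<open>0 < a\<close> \<open>a' < a\<close> by (auto simp: c_def)
  then have \<eta>: "0 < \<eta>" by (simp add: \<eta>_def power_strict_mono)
  \<comment> \<open>The term with weight \<open>k = 1 / (l + 2)\<close> is at most \<open>k * (4 * sup_norm X f)\<^sup>2\<close> and must not make up for the gap \<open>\<eta>\<close>.\<close>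
  let ?s = "sup_norm X f"
  obtain l :: nat where l: "16 * ?s\<^sup>2 / \<eta> < real l" using reals_Archimedean2 by blast
  define k where "k = 1 / real (l + 2)"
  have "0 < k" by (simp add: k_def)
  have small: "k * (4 * ?s)\<^sup>2 < \<eta>"
  proof -
    have "16 * ?s\<^sup>2 < \<eta> * real l" using l \<eta> by (simp add: field_simps)
    also have "\<dots> \<le> \<eta> * real (l + 2)" using \<eta> by simp
    finally show ?thesis by (simp add: k_def field_simps power_mult_distrib)
  qed
  define I where "I = {p \<in> close_pairs \<delta> (M \<union> base_union v). \<exists>\<gamma>. apart \<delta> p \<inter> b u = {\<gamma>}}"
  define L where "L p = \<Theta> \<delta> \<pi>s n (insert (the_elem (apart \<delta> p \<inter> b u)) M)" for p
  define N where "N p f = sqrt ((osc p f)\<^sup>2 + k * (L p f)\<^sup>2)" for p f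
  have I_K: "p \<in> K \<times> K" if "p \<in> I" for p
    using that close_pairs_sub unfolding I_def by blast
  have L: "lsc_seminorm X 4 (L p)" for p
    unfolding L_def by (rule lsc_seminorm_Theta)
  have N: "lsc_seminorm X 4 (N p)" if "p \<in> I" for p
    using lsc_seminorm_summand[OF I_K[OF that] L] unfolding N_def k_def .
  have N2: "(N p f)\<^sup>2 = (osc p f)\<^sup>2 + k * (L p f)\<^sup>2" for p
    using \<open>0 < k\<close> by (simp add: N_def)
  have p0_I: "p0 \<in> I" using p0 unfolding I_def by blast
  then have "I \<noteq> {}" by blast
  have lim: "(\<lambda>r. rotundity_defect X (sup_seminorm I N) f (F r)) \<longlonglongrightarrow> 0"
  proof -
    have "\<Theta> \<delta> ((v, u, l) # \<pi>s) n M = sup_seminorm I N"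
      unfolding \<Theta>.simps prod.case I_def N_def L_def k_def ..
    moreover have "(\<lambda>r. rotundity_defect X (\<Theta> \<delta> ((v, u, l) # \<pi>s) n M) f (F r)) \<longlonglongrightarrow> 0"
      using M unfolding pinned_def by blast
    ultimately show ?thesis by (simp only:)
  qed
  show "(\<lambda>r. rotundity_defect X (\<Theta> \<delta> \<pi>s n (insert \<gamma> M)) f (F r)) \<longlonglongrightarrow> 0"
  proof (rule order_tendstoI)
    fix e :: real assume "e < 0"
    then show "\<forall>\<^sub>F r in sequentially. e < rotundity_defect X (\<Theta> \<delta> \<pi>s n (insert \<gamma> M)) f (F r)"
      using rotundity_defect_nonneg[OF compact_K lsc_seminorm_Theta f F]
      by (intro always_eventually allI) (meson less_le_trans)
  next
    fix e :: real assume "0 < e"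
    define \<eta>' where "\<eta>' = min \<eta> (k * e / 2)"
    have "0 < \<eta>'" using \<eta> \<open>0 < e\<close> \<open>0 < k\<close> by (simp add: \<eta>'_def)
    from order_tendstoD(2)[OF lim this]
    show "\<forall>\<^sub>F r in sequentially. rotundity_defect X (\<Theta> \<delta> \<pi>s n (insert \<gamma> M)) f (F r) < e"
    proof eventually_elim
      case (elim r)
      have "\<exists>p\<in>I. rotundity_defect X (N p) f (F r) < 2 * \<eta>' \<and> (sup_seminorm I N f)\<^sup>2 - \<eta>' < (N p f)\<^sup>2"
        by (rule rotundity_defect_sup[where N = N and I = I and c = 4, OF compact_K _ _ f F \<open>I \<noteq> {}\<close> elim])
          (auto intro: N)
      then obtain p where p: "p \<in> I" and dp: "rotundity_defect X (N p) f (F r) < 2 * \<eta>'"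
        and np: "(sup_seminorm I N f)\<^sup>2 - \<eta>' < (N p f)\<^sup>2" by blast
      have "a\<^sup>2 \<le> (osc p0 f)\<^sup>2" using p0(3) \<open>0 < a\<close> by (simp add: power_mono)
      also have "\<dots> \<le> (N p0 f)\<^sup>2" unfolding N2 using \<open>0 < k\<close> by simp
      also have "\<dots> \<le> (sup_seminorm I N f)\<^sup>2"
        using le_sup_seminorm[of I X 4 N f p0] N f p0_I lsc_seminorm_nonneg[OF N[OF p0_I] f]
        by (simp add: power_mono)
      finally have "a\<^sup>2 \<le> (sup_seminorm I N f)\<^sup>2" .
      moreover have "k * (L p f)\<^sup>2 \<le> k * (4 * ?s)\<^sup>2"
        using lsc_seminorm_nonneg[OF L f] lsc_seminorm_le[OF L f] \<open>0 < k\<close>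
        by (intro mult_left_mono power_mono) auto
      moreover have "\<eta>' \<le> \<eta>" by (simp add: \<eta>'_def)
      ultimately have "a\<^sup>2 - \<eta> - \<eta> < (osc p f)\<^sup>2" using np small N2[of p] by linarith
      then have "c\<^sup>2 < (osc p f)\<^sup>2" by (simp add: \<eta>_def)
      then have "c < osc p f" by (rule power_less_imp_less_base) (simp add: osc_def)
      then have "\<gamma> \<in> apart \<delta> p" using a' p by (auto simp: c_def I_def)
      moreover have "\<gamma> \<in> b u" using p0(2) by blast
      moreover obtain \<gamma>' where "apart \<delta> p \<inter> b u = {\<gamma>'}" using p unfolding I_def by blast
      ultimately have "apart \<delta> p \<inter> b u = {\<gamma>}" by (metis IntI singletonD)
      then have Lp: "L p = \<Theta> \<delta> \<pi>s n (insert \<gamma> M)" by (simp add: L_def)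
      have "0 \<le> rotundity_defect X (osc p) f (F r)"
        by (rule rotundity_defect_nonneg[OF compact_K lsc_seminorm_osc[OF I_K[OF p]] f F])
      moreover have "rotundity_defect X (N p) f (F r)
          = rotundity_defect X (osc p) f (F r) + k * rotundity_defect X (L p) f (F r)"
        unfolding N_def using \<open>0 < k\<close> by (intro rotundity_defect_l2) simp
      ultimately have "k * rotundity_defect X (L p) f (F r) < 2 * \<eta>'"
        using dp by linarith
      also have "2 * \<eta>' \<le> k * e" by (simp add: \<eta>'_def)
      finally show ?case using \<open>0 < k\<close> by (simp add: Lp)
    qed
  qed
qed

section \<open>Finite sets that control a continuous function\<close>

lemma detects_unique:
  assumes "detects \<delta> a f M v u \<gamma>" "detects \<delta> a f M v u \<gamma>'"
  shows "\<gamma> = \<gamma>'"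
proof -
  obtain a' where a': "a' < a"
    "\<And>p. p \<in> close_pairs \<delta> (M \<union> base_union v) \<Longrightarrow> a' \<le> osc p f \<Longrightarrow> \<gamma> \<in> apart \<delta> p"
    using assms(1) by (auto simp: detects_def)
  obtain p where p: "p \<in> close_pairs \<delta> (M \<union> base_union v)" "apart \<delta> p \<inter> b u = {\<gamma>'}" "a \<le> osc p f"
    using assms(2) by (auto simp: detects_def)
  have "\<gamma> \<in> apart \<delta> p" using a' p by auto
  moreover have "\<gamma> \<in> b u" using assms(1) by (auto simp: detects_def)
  ultimately show ?thesis using p(2) by blast
qed

lemma detects_topspace: "detects \<delta> a f M v u \<gamma> \<Longrightarrow> \<gamma> \<in> G"
  by (auto simp: detects_def apart_def)

text \<open>If \<open>s\<close> and \<open>t\<close> were continuous at a point of \<open>A\<close>, their distance there would be at least \<open>\<delta>\<close>, by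
  accumulation of points where they are apart, and at most \<open>\<delta> / 2\<close>, by density of \<open>Q\<close>. So \<open>A\<close> consists of
  discontinuities of the two functions. This is where the hypothesis on \<open>K\<close> enters.\<close>

lemma countable_accumulation_of_apart:
  assumes p: "p \<in> near (\<delta> / 2) Q" and "0 < \<delta>"
    and A: "A \<subseteq> G" "\<And>x n. x \<in> A \<Longrightarrow> x \<in> b n \<Longrightarrow> apart \<delta> p \<inter> b n \<noteq> {}"
  shows "countable A"
proof -
  have pK: "fst p \<in> K" "snd p \<in> K" using p by (auto simp: near_def)
  have "A \<subseteq> discontinuities \<Gamma> (fst p) \<union> discontinuities \<Gamma> (snd p)"
  proof
    fix x assume x: "x \<in> A"
    show "x \<in> discontinuities \<Gamma> (fst p) \<union> discontinuities \<Gamma> (snd p)"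
    proof (rule ccontr)
      assume "\<not> ?thesis"
      then have "limitin euclideanreal (fst p) (fst p x) (atin \<Gamma> x)"
        "limitin euclideanreal (snd p) (snd p x) (atin \<Gamma> x)"
        using x A(1) by (auto simp: discontinuities_def topcontinuous_at_atin)
      then have "((\<lambda>y. gap p y) \<longlongrightarrow> gap p x) (atin \<Gamma> x)"
        unfolding gap_def by (auto intro: tendsto_intros)
      then have "\<forall>\<^sub>F y in atin \<Gamma> x. dist (gap p y) (gap p x) < \<delta> / 8"
        using \<open>0 < \<delta>\<close> by (intro tendstoD) auto
      then obtain U where U: "openin \<Gamma> U" "x \<in> U"
        "\<And>y. y \<in> U \<Longrightarrow> y \<noteq> x \<Longrightarrow> dist (gap p y) (gap p x) < \<delta> / 8"
        using x A(1) unfolding eventually_atin by blast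
      have near_x: "dist (gap p y) (gap p x) < \<delta> / 8" if "y \<in> U" for y
        using U(3)[OF that] \<open>0 < \<delta>\<close> by (cases "y = x") auto
      obtain n where n: "x \<in> b n" "b n \<subseteq> U" using b_base[OF U(1,2)] by blast
      obtain y where y: "y \<in> apart \<delta> p" "y \<in> b n" using A(2)[OF x n(1)] by blast
      have "x \<in> \<Gamma> closure_of Q" using x A(1) Q(3) by blast
      then obtain q where q: "q \<in> Q" "q \<in> U" using U(1,2) unfolding in_closure_of by blast
      have "gap p q \<le> \<delta> / 2" using p q(1) by (simp add: near_def)
      moreover have "\<delta> < gap p y" using y(1) by (simp add: apart_def)
      moreover have "dist (gap p q) (gap p x) < \<delta> / 8" "dist (gap p y) (gap p x) < \<delta> / 8"
        using near_x q(2) y(2) n(2) by blast+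
      ultimately show False using \<open>0 < \<delta>\<close> unfolding dist_real_def by linarith
    qed
  qed
  then show ?thesis
    using discont[OF pK(1)] discont[OF pK(2)] by (meson countable_Un countable_subset)
qed

text \<open>Basic open sets are added greedily to \<open>B\<close>, each one if a pair of oscillation at least \<open>a\<close> survives. By
  compactness such a pair survives in the limit, and the open set obtained is maximal with this property.\<close>

lemma maximal_base_union:
  assumes f: "f \<in> cont_funs X" and B: "B \<subseteq> G" and ex: "p0 \<in> close_pairs \<delta> B" "a \<le> osc p0 f"
  obtains v :: "nat \<Rightarrow> nat list" and p where
    "\<And>n. set (v n) \<subseteq> set (v (Suc n))"
    "\<And>n. p \<in> close_pairs \<delta> (B \<union> base_union (v n))" "a \<le> osc p f"
    "\<And>i n. i \<notin> set (v (Suc i)) \<Longrightarrow> {p \<in> close_pairs \<delta> (B \<union> base_union (v i) \<union> b i). a \<le> osc p f} = {}"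
proof -
  let ?feas = "\<lambda>w. {p \<in> close_pairs \<delta> (B \<union> base_union w). a \<le> osc p f} \<noteq> {}"
  define v where "v = rec_nat [] (\<lambda>n w. if ?feas (n # w) then n # w else w)"
  have v0: "v 0 = []" and vS: "v (Suc n) = (if ?feas (n # v n) then n # v n else v n)" for n
    by (simp_all add: v_def)
  have feas: "?feas (v n)" for n
  proof (induction n)
    case 0
    have "p0 \<in> {p \<in> close_pairs \<delta> (B \<union> base_union (v 0)). a \<le> osc p f}"
      using ex by (simp add: v0 base_union_def)
    then show ?case by blast
  qed (simp add: vS)
  have mono: "set (v n) \<subseteq> set (v (Suc n))" for n by (auto simp: vS)
  obtain p where p: "p \<in> close_pairs \<delta> (B \<union> base_union (v n)) \<inter> {p \<in> K \<times> K. a \<le> osc p f}" for n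
  proof (rule decseq_closed_pairs_nonempty[of "\<lambda>n. close_pairs \<delta> (B \<union> base_union (v n)) \<inter> {p \<in> K \<times> K. a \<le> osc p f}"])
    fix n
    have "B \<union> base_union (v n) \<subseteq> G" using B b_sub by (auto simp: base_union_def)
    then show "closedin (prod_topology X X) (close_pairs \<delta> (B \<union> base_union (v n)) \<inter> {p \<in> K \<times> K. a \<le> osc p f})"
      by (intro closedin_Int closedin_close_pairs closedin_osc_ge[OF f])
    show "close_pairs \<delta> (B \<union> base_union (v n)) \<inter> {p \<in> K \<times> K. a \<le> osc p f} \<noteq> {}"
      using feas[of n] close_pairs_sub by blast
    have "base_union (v n) \<subseteq> base_union (v (Suc n))"
      using mono[of n] by (auto simp: base_union_def)
    then show "close_pairs \<delta> (B \<union> base_union (v (Suc n))) \<inter> {p \<in> K \<times> K. a \<le> osc p f}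
      \<subseteq> close_pairs \<delta> (B \<union> base_union (v n)) \<inter> {p \<in> K \<times> K. a \<le> osc p f}"
      by (intro Int_mono close_pairs_antimono Un_mono order_refl)
  qed blast
  show thesis
  proof (rule that[of v p])
    fix i assume "i \<notin> set (v (Suc i))"
    then have "\<not> ?feas (i # v i)" by (auto simp: vS split: if_splits)
    moreover have "B \<union> base_union (i # v i) = B \<union> base_union (v i) \<union> b i" by (auto simp: base_union_def)
    ultimately show "{p \<in> close_pairs \<delta> (B \<union> base_union (v i) \<union> b i). a \<le> osc p f} = {}" by simp
  qed (use mono p in auto)
qed

text \<open>The core of the argument. Points are added to the empty set as long as any instruction detects one, where every
  instruction is tried infinitely often; let \<open>B\<close> be the countable set of all points found. If a pair close on \<open>B\<close>
  had oscillation at least \<open>a\<close>, choose a maximal open set \<open>V\<close> on which such a pair can still be close. For each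
  remaining pair the closure of the set where it is apart is the complement \<open>A\<close> of \<open>V\<close>, by maximality. The closed
  set \<open>A\<close> is countable and nonempty, so it has an isolated point \<open>\<gamma>\<close>, and every remaining pair is apart at \<open>\<gamma>\<close>.
  By compactness this is already decided by finitely many points of \<open>B\<close> and finitely many basic subsets of \<open>V\<close>, so some
  instruction detects \<open>\<gamma>\<close>. Thus \<open>\<gamma>\<close> belongs to \<open>B\<close>, where the pair is close: a contradiction. Hence \<open>B\<close>
  controls \<open>f\<close>, and by compactness a finite part of it does.\<close>

lemma pinned_set_controls:
  assumes f: "f \<in> cont_funs X" and F: "\<And>r. F r \<in> cont_funs X" and "0 < a" "0 < \<delta>"
    and \<delta>: "\<And>p. p \<in> near \<delta> G \<Longrightarrow> osc p f < a" and start: "pinned \<delta> f F {}"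
  obtains M n where "finite M" "M \<subseteq> G" "pinned \<delta> f F M"
    "\<And>p. p \<in> near (\<delta> / 2) (Q_part n) \<inter> near \<delta> M \<Longrightarrow> osc p f < a"
proof -
  \<comment> \<open>The pairing function makes every instruction occur at arbitrarily late stages.\<close>
  define param :: "nat \<Rightarrow> nat list \<times> nat" where "param k = from_nat (fst (prod_decode k))" for k
  have param_inf: "\<exists>k\<ge>n. param k = \<pi>" for n \<pi>
    by (rule exI[of _ "prod_encode (to_nat \<pi>, n)"]) (simp add: param_def le_prod_encode_2)
  let ?D = "\<lambda>k M. detects \<delta> a f M (fst (param k)) (snd (param k))"
  define M where "M = rec_nat {} (\<lambda>k M. if \<exists>\<gamma>. ?D k M \<gamma> then insert (SOME \<gamma>. ?D k M \<gamma>) M else M)"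
  have M0: "M 0 = {}"
    and MS: "M (Suc k) = (if \<exists>\<gamma>. ?D k (M k) \<gamma> then insert (SOME \<gamma>. ?D k (M k) \<gamma>) (M k) else M k)" for k
    by (simp_all only: M_def old.nat.rec)
  have M: "finite (M k) \<and> M k \<subseteq> G \<and> pinned \<delta> f F (M k)" for k
  proof (induction k)
    case (Suc k)
    show ?case
    proof (cases "\<exists>\<gamma>. ?D k (M k) \<gamma>")
      case True
      then have "?D k (M k) (SOME \<gamma>. ?D k (M k) \<gamma>)" by (rule someI_ex)
      then show ?thesis
        using Suc True pinned_insert[OF f F \<open>0 < a\<close>] detects_topspace by (simp add: MS)
    qed (simp add: MS Suc)
  qed (simp add: M0 start)
  have mono1: "M k \<subseteq> M (Suc k)" for k by (auto simp: MS)
  then have mono: "M k \<subseteq> M m" if "k \<le> m" for k m using that by (rule lift_Suc_mono_le)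
  define B where "B = (\<Union>k. M k)"
  have B: "B \<subseteq> G" using M by (auto simp: B_def)
  have small: "osc p f < a" if pB: "p \<in> close_pairs \<delta> B" for p
  proof (rule ccontr)
    assume "\<not> osc p f < a"
    then have ge: "a \<le> osc p f" by simp
    obtain v q where
      v_mono: "\<And>n. set (v n) \<subseteq> set (v (Suc n))" and
      q: "\<And>n. q \<in> close_pairs \<delta> (B \<union> base_union (v n))" "a \<le> osc q f" and
      v_max: "\<And>i n. i \<notin> set (v (Suc i)) \<Longrightarrow>
        {p \<in> close_pairs \<delta> (B \<union> base_union (v i) \<union> b i). a \<le> osc p f} = {}"
      by (rule maximal_base_union[OF f B pB ge]) blast
    define V where "V = (\<Union>n. base_union (v n))"
    define A where "A = G - V"
    \<comment> \<open>For every pair that survives all stages, \<open>A\<close> is the closure of the set where the pair is apart.\<close>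
    have top: "apart \<delta> p \<subseteq> A \<and> (\<forall>x\<in>A. \<forall>i. x \<in> b i \<longrightarrow> apart \<delta> p \<inter> b i \<noteq> {})"
      if p: "\<And>n. p \<in> close_pairs \<delta> (B \<union> base_union (v n))" "a \<le> osc p f" for p
    proof (intro conjI ballI allI impI)
      show "apart \<delta> p \<subseteq> A"
      proof
        fix x assume x: "x \<in> apart \<delta> p"
        have "x \<notin> base_union (v n)" for n
        proof
          assume "x \<in> base_union (v n)"
          then have "gap p x \<le> \<delta>" using p(1)[of n] by (simp add: close_pairs_def near_def)
          then show False using x by (simp add: apart_def)
        qed
        then show "x \<in> A" using x by (simp add: A_def V_def apart_def)
      qed
      fix x i assume x: "x \<in> A" "x \<in> b i"
      then have "i \<notin> set (v (Suc i))" by (auto simp: A_def V_def base_union_def)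
      from v_max[OF this] p(2) have "p \<notin> close_pairs \<delta> (B \<union> base_union (v i) \<union> b i)" by blast
      with p(1)[of i] obtain y where "y \<in> b i" "\<delta> < gap p y"
        by (auto simp: close_pairs_def near_def)
      then show "apart \<delta> p \<inter> b i \<noteq> {}" using b_sub by (auto simp: apart_def)
    qed
    have "q \<in> near (\<delta> / 2) Q" using q(1) by (simp add: close_pairs_def)
    then have "countable A"
      using top[OF q] \<open>0 < \<delta>\<close> by (intro countable_accumulation_of_apart[of q \<delta> A]) (auto simp: A_def)
    moreover have "closedin \<Gamma> A"
      using b_open by (auto simp: A_def V_def base_union_def intro!: openin_Union)
    moreover have "A \<noteq> {}"
    proof -
      have "q \<in> K \<times> K" using q(1) close_pairs_sub by blast
      then have "apart \<delta> q \<noteq> {}" using \<delta>[of q] q(2) by (force simp: near_def apart_def)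
      then show ?thesis using top[OF q] by blast
    qed
    ultimately obtain U \<gamma> where U: "openin \<Gamma> U" "U \<inter> A = {\<gamma>}"
      using countable_closedin_isolated_point[OF metrizable] by metis
    then obtain u where u: "\<gamma> \<in> b u" "b u \<subseteq> U" using b_base by blast
    have isolated: "apart \<delta> p \<inter> b u = {\<gamma>}"
      if p: "\<And>n. p \<in> close_pairs \<delta> (B \<union> base_union (v n))" "a \<le> osc p f" for p
    proof -
      have "apart \<delta> p \<inter> b u \<subseteq> {\<gamma>}" using top[OF p] u(2) U(2) by blast
      moreover have "apart \<delta> p \<inter> b u \<noteq> {}" using top[OF p] u(1) U(2) by blast
      ultimately show ?thesis by blast
    qed
    have \<gamma>G: "\<gamma> \<in> G" using u(1) b_sub by blast
    \<comment> \<open>Thresholds increasing to \<open>a\<close>, so that the sets below decrease to the surviving pairs that are close at \<open>\<gamma>\<close>.\<close>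
    define c where "c n = a * (1 - 1 / real (Suc n))" for n
    have c_less: "c n < a" for n using \<open>0 < a\<close> by (simp add: c_def field_simps)
    have c_mono: "c n \<le> c (Suc n)" for n
    proof -
      have "1 / real (Suc (Suc n)) \<le> 1 / real (Suc n)" by (simp add: field_simps)
      then show ?thesis unfolding c_def using \<open>0 < a\<close> by (intro mult_left_mono) auto
    qed
    have c_lim: "c \<longlonglongrightarrow> a"
    proof -
      have "(\<lambda>n. 1 / real (Suc n)) \<longlonglongrightarrow> 0" by (rule LIMSEQ_Suc[OF lim_1_over_n])
      then have "(\<lambda>n. a * (1 - 1 / real (Suc n))) \<longlonglongrightarrow> a * (1 - 0)" by (intro tendsto_intros)
      then show ?thesis by (simp add: c_def[abs_def])
    qed
    let ?C = "\<lambda>n. close_pairs \<delta> (M n \<union> base_union (v n)) \<inter> {p \<in> K \<times> K. c n \<le> osc p f}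
      \<inter> {p \<in> K \<times> K. gap p \<gamma> \<le> \<delta>}"
    have "\<exists>n. ?C n = {}"
    proof (rule ccontr)
      assume ne: "\<not> ?thesis"
      obtain p where p: "p \<in> ?C n" for n
      proof (rule decseq_closed_pairs_nonempty[of ?C])
        fix n
        have "M n \<union> base_union (v n) \<subseteq> G" using M b_sub by (auto simp: base_union_def)
        then show "closedin (prod_topology X X) (?C n)"
          by (intro closedin_Int closedin_close_pairs closedin_osc_ge[OF f] closedin_gap_le \<gamma>G)
        show "?C n \<noteq> {}" using ne by blast
        have "base_union (v n) \<subseteq> base_union (v (Suc n))" using v_mono[of n] by (auto simp: base_union_def)
        then have "close_pairs \<delta> (M (Suc n) \<union> base_union (v (Suc n))) \<subseteq> close_pairs \<delta> (M n \<union> base_union (v n))"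
          by (intro close_pairs_antimono Un_mono mono1)
        then show "?C (Suc n) \<subseteq> ?C n" using c_mono[of n] by auto
      qed blast
      have vm: "base_union (v n) \<subseteq> base_union (v m)" if "n \<le> m" for n m
      proof -
        have "set (v n) \<subseteq> set (v m)" using v_mono that by (rule lift_Suc_mono_le)
        then show ?thesis by (auto simp: base_union_def)
      qed
      have "p \<in> close_pairs \<delta> (B \<union> base_union (v n))" for n
      proof -
        have "gap p x \<le> \<delta>" if x: "x \<in> B \<union> base_union (v n)" for x
        proof -
          obtain k where "x \<in> M k \<union> base_union (v n)" using x by (auto simp: B_def)
          then have "x \<in> M (max k n) \<union> base_union (v (max k n))"
            using mono[of k "max k n"] vm[of n "max k n"] by auto
          then show ?thesis using p[of "max k n"] unfolding close_pairs_def near_def by blast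
        qed
        then show ?thesis using p[of 0] by (auto simp: close_pairs_def near_def)
      qed
      moreover have "a \<le> osc p f" by (rule LIMSEQ_le_const2[OF c_lim]) (use p in auto)
      ultimately have "\<gamma> \<in> apart \<delta> p" using isolated[of p] by blast
      then show False using p[of 0] by (simp add: apart_def)
    qed
    then obtain n where n: "?C n = {}" by blast
    \<comment> \<open>The conditions only get easier for later stages, so a stage \<open>k \<ge> n\<close> with the right instruction can be used.\<close>
    obtain k where k: "n \<le> k" "param k = (v n, u)" using param_inf by blast
    have anti: "close_pairs \<delta> (M k \<union> base_union (v n)) \<subseteq> close_pairs \<delta> (M n \<union> base_union (v n))"
      by (intro close_pairs_antimono Un_mono mono k(1) order_refl)
    have "detects \<delta> a f (M k) (v n) u \<gamma>"
      unfolding detects_def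
    proof (intro conjI exI[of _ "c n"] ballI impI)
      have "close_pairs \<delta> (B \<union> base_union (v n)) \<subseteq> close_pairs \<delta> (M k \<union> base_union (v n))"
        by (intro close_pairs_antimono Un_mono) (auto simp: B_def)
      then show "\<exists>p\<in>close_pairs \<delta> (M k \<union> base_union (v n)). apart \<delta> p \<inter> b u = {\<gamma>} \<and> a \<le> osc p f"
        using q isolated[OF q] by blast
      show "c n < a" by (rule c_less)
      fix p assume "p \<in> close_pairs \<delta> (M k \<union> base_union (v n))" "c n \<le> osc p f"
      then have "p \<in> close_pairs \<delta> (M n \<union> base_union (v n))" "p \<in> K \<times> K" "c n \<le> osc p f"
        using anti close_pairs_sub by blast+
      with n have "\<not> gap p \<gamma> \<le> \<delta>" by blast
      then show "\<gamma> \<in> apart \<delta> p" using \<gamma>G by (simp add: apart_def)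
    qed
    then have det: "?D k (M k) \<gamma>" by (simp add: k(2))
    then have "(SOME \<gamma>. ?D k (M k) \<gamma>) = \<gamma>"
      by (intro some_equality) (auto intro: detects_unique)
    then have "\<gamma> \<in> M (Suc k)" using det by (auto simp: MS)
    then have "\<gamma> \<in> B" by (auto simp: B_def)
    then have "gap q \<gamma> \<le> \<delta>" using q(1)[of 0] by (auto simp: close_pairs_def near_def)
    moreover have "\<gamma> \<in> apart \<delta> q" using isolated[OF q] by blast
    ultimately show False by (simp add: apart_def)
  qed
  let ?H = "\<lambda>n. near (\<delta> / 2) (Q_part n) \<inter> near \<delta> (M n) \<inter> {p \<in> K \<times> K. a \<le> osc p f}"
  have "\<exists>n. ?H n = {}"
  proof (rule ccontr)
    assume ne: "\<not> ?thesis"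
    obtain p where p: "p \<in> ?H n" for n
    proof (rule decseq_closed_pairs_nonempty[of ?H])
      fix n
      have "Q_part n \<subseteq> G" using Q(2) by (auto simp: Q_part_def)
      then show "closedin (prod_topology X X) (?H n)"
        using M by (intro closedin_Int closedin_near closedin_osc_ge[OF f]) auto
      show "?H n \<noteq> {}" using ne by blast
      show "?H (Suc n) \<subseteq> ?H n"
        by (intro Int_mono near_antimono mono1 Q_part_mono) auto
    qed blast
    then have "p \<in> near (\<delta> / 2) (Q_part n)" "p \<in> near \<delta> (M n)" for n by blast+
    then have "p \<in> near (\<delta> / 2) (\<Union>n. Q_part n)" "p \<in> near \<delta> (\<Union>n. M n)"
      unfolding near_def by blast+
    then have "p \<in> close_pairs \<delta> B" by (simp add: close_pairs_def B_def Q_eq_Union[symmetric])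
    then have "osc p f < a" by (rule small)
    moreover have "a \<le> osc p f" using p[of 0] by blast
    ultimately show False by simp
  qed
  then obtain n where n: "?H n = {}" by blast
  show thesis
  proof (rule that[of "M n" n])
    fix p assume p: "p \<in> near (\<delta> / 2) (Q_part n) \<inter> near \<delta> (M n)"
    then have "p \<in> K \<times> K" by (simp add: near_def)
    with p n have "\<not> a \<le> osc p f" by blast
    then show "osc p f < a" by simp
  qed (use M in auto)
qed

section \<open>Uniform convergence and the norm\<close>

lemma finite_net:
  assumes "finite S" "S \<subseteq> G" "0 < \<epsilon>"
  obtains D' where "finite D'" "D' \<subseteq> D" "\<And>s. s \<in> K \<Longrightarrow> \<exists>d\<in>D'. \<forall>\<gamma>\<in>S. \<bar>s \<gamma> - d \<gamma>\<bar> < \<epsilon>"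
proof -
  define W where "W d = {s \<in> topspace X. \<forall>\<gamma>\<in>S. \<bar>s \<gamma> - d \<gamma>\<bar> < \<epsilon>}" for d :: "'g \<Rightarrow> real"
  have W_open: "openin X (W d)" for d
  proof -
    have 1: "openin X {s \<in> topspace X. \<bar>s \<gamma> - d \<gamma>\<bar> \<in> {..<\<epsilon>}}" if "\<gamma> \<in> S" for \<gamma>
    proof (rule openin_continuous_map_preimage[of _ euclideanreal])
      have "continuous_map X euclideanreal (\<lambda>s. s \<gamma>)"
        using that assms(2) by (intro continuous_map_from_subtopology continuous_map_product_projection) auto
      then show "continuous_map X euclideanreal (\<lambda>s. \<bar>s \<gamma> - d \<gamma>\<bar>)"
        by (intro continuous_map_real_abs continuous_map_diff continuous_map_canonical_const)
    qed auto
    have eq: "W d = topspace X \<inter> (\<Inter>\<gamma>\<in>S. {s \<in> topspace X. \<bar>s \<gamma> - d \<gamma>\<bar> \<in> {..<\<epsilon>}})"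
      by (auto simp: W_def)
    show ?thesis
    proof (cases "S = {}")
      case False
      then show ?thesis unfolding eq by (intro openin_Int openin_INT2 openin_topspace 1 assms(1))
    qed (simp add: W_def del: topspace_subtopology)
  qed
  have cover: "topspace X \<subseteq> \<Union>(W ` D)"
  proof
    fix s assume s: "s \<in> topspace X"
    then have "s \<in> X closure_of D" by (simp only: D(3) topspace_X)
    moreover have "s \<in> W s" using s \<open>0 < \<epsilon>\<close> by (simp add: W_def del: topspace_subtopology)
    ultimately obtain d where d: "d \<in> D" "d \<in> W s" using W_open[of s] by (metis in_closure_of)
    have "s \<in> W d" using s d(2) by (simp add: W_def abs_minus_commute del: topspace_subtopology)
    then show "s \<in> \<Union>(W ` D)" using d(1) by blast
  qed
  have "compactin X (topspace X)" using compact_K by (simp add: compact_space_def)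
  then have "\<exists>\<F>. finite \<F> \<and> \<F> \<subseteq> W ` D \<and> topspace X \<subseteq> \<Union>\<F>"
    by (rule compactinD) (use W_open cover in auto)
  then obtain \<F> where \<F>: "finite \<F>" "\<F> \<subseteq> W ` D" "topspace X \<subseteq> \<Union>\<F>" by blast
  then obtain D' where D': "finite D'" "D' \<subseteq> D" "\<F> = W ` D'"
    by (meson finite_subset_image)
  show thesis
  proof (rule that[OF D'(1,2)])
    fix s assume "s \<in> K"
    then have "s \<in> topspace X" by (simp only: topspace_X)
    then obtain d where "d \<in> D'" "s \<in> W d" using \<F>(3) D'(3) by blast
    then show "\<exists>d\<in>D'. \<forall>\<gamma>\<in>S. \<bar>s \<gamma> - d \<gamma>\<bar> < \<epsilon>" unfolding W_def by blast
  qed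
qed

text \<open>Once a finite set controls \<open>f\<close> and, because it is pinned, also \<open>F r\<close> for large \<open>r\<close>, the two functions are determined up to a
  small error by their values on a finite net in \<open>D\<close>, and there \<open>F r\<close> converges to \<open>f\<close>.\<close>

lemma uniform_convergence:
  assumes f: "f \<in> cont_funs X" and F: "\<And>r. F r \<in> cont_funs X"
    and ev: "\<And>d. d \<in> D \<Longrightarrow> (\<lambda>r. rotundity_defect X (\<lambda>f. \<bar>f d\<bar>) f (F r)) \<longlonglongrightarrow> 0"
    and pin: "\<And>e. pinned (1 / Suc e) f F {}"
  shows "(\<lambda>r. sup_norm X (fun_diff K f (F r))) \<longlonglongrightarrow> 0"
proof (rule LIMSEQ_I)
  fix \<epsilon> :: real assume "0 < \<epsilon>"
  \<comment> \<open>The three parts of the estimate contribute \<open>a\<close>, \<open>a\<close> and \<open>2 * a\<close>.\<close>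
  define a where "a = \<epsilon> / 6"
  have "0 < a" using \<open>0 < \<epsilon>\<close> by (simp add: a_def)
  obtain e where e: "\<And>p. p \<in> near (1 / Suc e) G \<Longrightarrow> osc p f < a"
    using osc_small_of_near[OF f \<open>0 < a\<close>] by blast
  define \<delta> where "\<delta> = 1 / real (Suc e)"
  have "0 < \<delta>" by (simp add: \<delta>_def)
  have small: "osc p f < a" if "p \<in> near \<delta> G" for p
    using that unfolding \<delta>_def by (rule e)
  have "pinned \<delta> f F {}" unfolding \<delta>_def by (rule pin)
  from pinned_set_controls[OF f F \<open>0 < a\<close> \<open>0 < \<delta>\<close> _ this] small
  obtain M n where M: "finite M" "M \<subseteq> G" "pinned \<delta> f F M"
    and ctrl: "\<And>p. p \<in> near (\<delta> / 2) (Q_part n) \<inter> near \<delta> M \<Longrightarrow> osc p f < a"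
    by blast
  let ?P = "near (\<delta> / 2) (Q_part n) \<inter> near \<delta> M"
  have \<Theta>: "\<Theta> \<delta> [] n M = sup_seminorm ?P osc" by simp
  note N = lsc_seminorm_Theta[of \<delta> "[]" n M]
  have "\<Theta> \<delta> [] n M f \<le> a"
    unfolding \<Theta> by (rule sup_seminorm_le) (use ctrl \<open>0 < a\<close> less_imp_le in blast)+
  have le_Theta: "osc p g \<le> \<Theta> \<delta> [] n M g" if "p \<in> ?P" "g \<in> cont_funs X" for p g
    unfolding \<Theta>
  proof (rule le_sup_seminorm[of ?P X 2 osc, OF _ that(2,1)])
    show "lsc_seminorm X 2 (osc p)" if "p \<in> ?P" for p
      using that by (intro lsc_seminorm_osc) (simp add: near_def)
  qed
  have "(\<lambda>r. rotundity_defect X (\<Theta> \<delta> [] n M) f (F r)) \<longlonglongrightarrow> 0"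
    using M(3) unfolding pinned_def by blast
  then have "\<forall>\<^sub>F r in sequentially. rotundity_defect X (\<Theta> \<delta> [] n M) f (F r) < a\<^sup>2"
    using \<open>0 < a\<close> by (intro order_tendstoD(2)) auto
  then have ev1: "\<forall>\<^sub>F r in sequentially. \<Theta> \<delta> [] n M (F r) \<le> 2 * a"
  proof eventually_elim
    case (elim r)
    have "(\<Theta> \<delta> [] n M f - \<Theta> \<delta> [] n M (F r))\<^sup>2 < a\<^sup>2"
      using rotundity_defect_ge[OF compact_K N f F, of r] elim by linarith
    then have "\<bar>\<Theta> \<delta> [] n M f - \<Theta> \<delta> [] n M (F r)\<bar> < a"
      using \<open>0 < a\<close> by (metis abs_le_square_iff abs_of_pos not_less)
    then show ?case using \<open>\<Theta> \<delta> [] n M f \<le> a\<close> by linarith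
  qed
  have S: "finite (Q_part n \<union> M)" "Q_part n \<union> M \<subseteq> G"
    using M finite_Q_part Q(2) by (auto simp: Q_part_def)
  obtain D' where D': "finite D'" "D' \<subseteq> D"
    "\<And>s. s \<in> K \<Longrightarrow> \<exists>d\<in>D'. \<forall>\<gamma>\<in>Q_part n \<union> M. \<bar>s \<gamma> - d \<gamma>\<bar> < \<delta> / 2"
    using finite_net[OF S, of "\<delta> / 2"] \<open>0 < \<delta>\<close> by auto
  have ev_d: "\<forall>\<^sub>F r in sequentially. \<bar>f d - F r d\<bar> < a" if "d \<in> D" for d
  proof -
    have "d \<in> K" using that D(2) by blast
    then have "rotundity_defect X (\<lambda>f. \<bar>f d\<bar>) f (F r) = (f d - F r d)\<^sup>2" for r
      using topspace_X by (simp add: rotundity_defect_def fun_add_def power2_eq_square algebra_simps del: topspace_subtopology)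
    then have "(\<lambda>r. f d - F r d) \<longlonglongrightarrow> 0" using ev[OF that] by simp
    from tendstoD[OF this \<open>0 < a\<close>] show ?thesis by simp
  qed
  have "\<forall>\<^sub>F r in sequentially. \<forall>d\<in>D'. \<bar>f d - F r d\<bar> < a"
    using D'(1,2) ev_d by (intro eventually_ball_finite) auto
  with ev1 have "\<forall>\<^sub>F r in sequentially. norm (sup_norm X (fun_diff K f (F r)) - 0) < \<epsilon>"
  proof eventually_elim
    case (elim r)
    have "sup_norm X (fun_diff K f (F r)) \<le> 4 * a"
    proof (rule sup_norm_le)
      show "fun_diff K f (F r) \<in> cont_funs X"
        using fun_diff_in_cont_funs[OF compact_K f F] unfolding topspace_X .
      fix s assume "s \<in> topspace X"
      then have s: "s \<in> K" by (simp only: topspace_X)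
      obtain d where d: "d \<in> D'" "\<forall>\<gamma>\<in>Q_part n \<union> M. \<bar>s \<gamma> - d \<gamma>\<bar> < \<delta> / 2"
        using D'(3)[OF s] by blast
      have "gap (s, d) \<gamma> < \<delta> / 2" if "\<gamma> \<in> Q_part n \<union> M" for \<gamma>
        using d(2) that by (simp add: gap_def)
      then have "gap (s, d) \<gamma> \<le> \<delta> / 2 \<and> gap (s, d) \<gamma> \<le> \<delta>" if "\<gamma> \<in> Q_part n \<union> M" for \<gamma>
        using that \<open>0 < \<delta>\<close> by (smt (verit) field_sum_of_halves)
      moreover have "d \<in> K" using d(1) D'(2) D(2) by blast
      ultimately have sd: "(s, d) \<in> ?P" using s by (simp add: near_def)
      have "osc (s, d) f \<le> a"
        using le_Theta[OF sd f] \<open>\<Theta> \<delta> [] n M f \<le> a\<close> by (rule order_trans)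
      moreover have "osc (s, d) (F r) \<le> 2 * a"
        using le_Theta[OF sd F] elim(1) by (rule order_trans)
      moreover have "\<bar>f d - F r d\<bar> < a" using elim(2) d(1) by blast
      ultimately have "\<bar>f s - F r s\<bar> \<le> 4 * a" unfolding osc_def fst_conv snd_conv by linarith
      then show "\<bar>fun_diff K f (F r) s\<bar> \<le> 4 * a" using s by (simp add: fun_diff_def)
    qed (use \<open>0 < a\<close> in simp)
    then have "sup_norm X (fun_diff K f (F r)) < \<epsilon>" using \<open>0 < \<epsilon>\<close> unfolding a_def by linarith
    then show ?case
      unfolding diff_0_right real_norm_def abs_of_nonneg[OF sup_norm_nonneg] .
  qed
  then show "\<exists>no. \<forall>r\<ge>no. norm (sup_norm X (fun_diff K f (F r)) - 0) < \<epsilon>"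
    unfolding eventually_sequentially .
qed

theorem exists_lur_norm:
  "\<exists>\<nu>. norm_on K (cont_funs X) \<nu> \<and> equivalent_norms_on (cont_funs X) (sup_norm X) \<nu> \<and>
     lower_semicontinuous_map (pointwise_topology X) \<nu> \<and>
     locally_uniformly_rotund_on K (cont_funs X) \<nu>"
proof -
  define \<N> where "\<N> = insert (sup_norm X) ((\<lambda>d f. \<bar>f d\<bar>) ` D \<union>
    range (\<lambda>(e, \<pi>s, n). \<Theta> (1 / Suc e) \<pi>s n {}))"
  have "\<exists>\<nu>. norm_on (topspace X) (cont_funs X) \<nu> \<and> equivalent_norms_on (cont_funs X) (sup_norm X) \<nu> \<and>
     lower_semicontinuous_map (pointwise_topology X) \<nu> \<and>
     locally_uniformly_rotund_on (topspace X) (cont_funs X) \<nu>"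
  proof (rule renorming_criterion[OF compact_K, of \<N> 4])
    show "countable \<N>" using D(1) unfolding \<N>_def by (intro countable_insert countable_Un) auto
    show "sup_norm X \<in> \<N>" by (simp add: \<N>_def)
    fix N assume "N \<in> \<N>"
    then consider "N = sup_norm X" | d where "d \<in> D" "N = (\<lambda>f. \<bar>f d\<bar>)"
      | e \<pi>s n where "N = \<Theta> (1 / Suc e) \<pi>s n {}"
      unfolding \<N>_def by auto
    then show "lsc_seminorm X 4 N"
    proof cases
      case 1
      then show ?thesis using lsc_seminorm_mono[OF lsc_seminorm_sup_norm[OF compact_K]] by simp
    next
      case 2
      then have "d \<in> topspace X" using D(2) topspace_X by blast
      then show ?thesis using lsc_seminorm_mono[OF lsc_seminorm_eval, of d X 4] 2 by (simp del: topspace_subtopology)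
    qed (simp add: lsc_seminorm_Theta)
  next
    fix f F
    assume f: "f \<in> cont_funs X" and F: "\<And>r. F r \<in> cont_funs X"
      and lim: "\<And>N. N \<in> \<N> \<Longrightarrow> (\<lambda>r. rotundity_defect X N f (F r)) \<longlonglongrightarrow> 0"
    have "(\<lambda>r. sup_norm X (fun_diff K f (F r))) \<longlonglongrightarrow> 0"
    proof (rule uniform_convergence[OF f F])
      show "(\<lambda>r. rotundity_defect X (\<lambda>f. \<bar>f d\<bar>) f (F r)) \<longlonglongrightarrow> 0" if "d \<in> D" for d
        using that by (intro lim) (simp add: \<N>_def)
      show "pinned (1 / Suc e) f F {}" for e
        unfolding pinned_def
      proof (intro allI lim)
        fix \<pi>s n
        show "\<Theta> (1 / Suc e) \<pi>s n {} \<in> \<N>"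
          unfolding \<N>_def by (intro insertI2 UnI2 range_eqI[of _ _ "(e, \<pi>s, n)"]) simp
      qed
    qed
    then show "(\<lambda>r. sup_norm X (fun_diff (topspace X) f (F r))) \<longlonglongrightarrow> 0" by (simp only: topspace_X)
  qed
  then show ?thesis by (simp only: topspace_X)
qed

end

theorem theorem1:
  fixes \<Gamma> :: "'g topology"
    and K :: "('g \<Rightarrow> real) set"
  assumes "polish_topology \<Gamma>"
    and "K \<subseteq> topspace \<Gamma> \<rightarrow>\<^sub>E UNIV"
    and "compact_space (subtopology (powertop_real (topspace \<Gamma>)) K)"
    and "separable_space (subtopology (powertop_real (topspace \<Gamma>)) K)"
    and "\<And>f. f \<in> K \<Longrightarrow> countable (discontinuities \<Gamma> f)"
  shows "let X = subtopology (powertop_real (topspace \<Gamma>)) K in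
           \<exists>\<nu> :: (('g \<Rightarrow> real) \<Rightarrow> real) \<Rightarrow> real.
             norm_on K (cont_funs X) \<nu> \<and>
             equivalent_norms_on (cont_funs X) (sup_norm X) \<nu> \<and>
             lower_semicontinuous_map (pointwise_topology X) \<nu> \<and>
             locally_uniformly_rotund_on K (cont_funs X) \<nu>"
proof -
  let ?X = "subtopology (powertop_real (topspace \<Gamma>)) K"
  have top: "topspace ?X = K" using assms(2) by auto
  obtain b where b: "\<And>n. openin \<Gamma> (b n)"
    "\<And>U x. openin \<Gamma> U \<Longrightarrow> x \<in> U \<Longrightarrow> \<exists>n :: nat. x \<in> b n \<and> b n \<subseteq> U"
    using polish_topology_countable_base[OF assms(1)] by metis
  obtain Q where Q: "countable Q" "Q \<subseteq> topspace \<Gamma>" "\<Gamma> closure_of Q = topspace \<Gamma>"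
    using assms(1) by (auto simp: polish_topology_def separable_space_def)
  obtain D where D: "countable D" "D \<subseteq> K" "?X closure_of D = K"
    using assms(4) unfolding separable_space_def top by blast
  interpret compactum_with_countable_discontinuities \<Gamma> K Q b D
    using assms b Q D by unfold_locales (auto simp: polish_topology_def)
  show ?thesis unfolding Let_def by (rule exists_lur_norm)
qed

end
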